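(* Let $Y$ be a standard Gaussian random variable. For each $n$, let $t^{(n)}$ be a cycle type of size $n$ and $\tau_n$ be a uniformly random $t^{(n)}$-cyclic permutation. Fix an integer $r\ge1$ and $\pi\in\mathfrak{S}_r$. Then for any $n$ with $\mathrm{Var}[X_\pi(\tau_n)]>0$: $$d_K\left(\frac{X_\pi(\tau_n)-\mathbb{E}[X_\pi(\tau_n)]}{\sqrt{\mathrm{Var}[X_\pi(\tau_n)]}},\,Y\right)\le42\,\frac{r}{((r-1)!)^2}\,\frac{n^{2r-3/2}}{\mathrm{Var}[X_\pi(\tau_n)]}+72\,\frac{r}{((r-1)!)^3}\,\frac{n^{3r-2}}{\mathrm{Var}[X_\pi(\tau_n)]^{3/2}}.$$ Furthermore, if $\mathrm{Var}[X_\pi(\tau_n)]=\sigma^2n^{2r-1}+o(n^{2r-1})$ as $n\to\infty$ for some $\sigma\ge0$, then $$\frac{X_\pi(\tau_n)-\mathbb{E}[X_\pi(\tau_n)]}{n^{r-1/2}}\underset{n\to\infty}{\longrightarrow}\mathcal{N}(0,\sigma^2)$$ in distribution, and if moreover $\sigma>0$ then the Kolmogorov distance on the left-hand side of the first display is $O(n^{-1/2})$.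
   Context: $[n]=\{1,\dots,n\}$ and $\mathfrak{S}_r$ is the set of permutations of $[r]$. A cycle type of size $n$ is a sequence $t=(t_1,\dots,t_n)$ of nonnegative integers with $\sum_{p=1}^n p\,t_p=n$; a permutation of $[n]$ is $t$-cyclic if it has exactly $t_p$ cycles of length $p$ for every $p$. For $\tau\in\mathfrak{S}_n$ and $\pi\in\mathfrak{S}_r$, the pattern count $X_\pi(\tau)$ is the number of subsets $\{i_1<\dots<i_r\}$ of $[n]$ such that for all $j,k\in[r]$, $\pi(j)>\pi(k)\iff\tau(i_j)>\tau(i_k)$. $d_K$ is the Kolmogorov distance between the laws of real random variables: $d_K(A,B)=\sup_{x\in\mathbb{R}}|\mathbf{P}(A\le x)-\mathbf{P}(B\le x)|$. $\mathcal{N}(0,0)$ is the Dirac mass at $0$. *)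

theory Defs
  imports "HOL-Probability.Probability" "HOL-Combinatorics.Orbits" "HOL-Library.Landau_Symbols"
begin

text \<open>
  A cycle type of size \<open>n\<close> is a function of which only the values at \<open>1, ..., n\<close> matter.
  Permutations of \<open>[n]\<close> are functions that permute \<open>{1..n}\<close>.
\<close>

definition cycle_type :: "nat \<Rightarrow> (nat \<Rightarrow> nat) \<Rightarrow> bool" where
  "cycle_type n t \<longleftrightarrow> (\<Sum>p = 1..n. p * t p) = n"

definition cycles_of :: "nat \<Rightarrow> (nat \<Rightarrow> nat) \<Rightarrow> nat set set" where
  "cycles_of n \<tau> = orbit \<tau> ` {1..n}"

definition cyclic_perms :: "nat \<Rightarrow> (nat \<Rightarrow> nat) \<Rightarrow> (nat \<Rightarrow> nat) set" where
  "cyclic_perms n t =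
     {\<tau>. \<tau> permutes {1..n} \<and> (\<forall>p\<in>{1..n}. card {C \<in> cycles_of n \<tau>. card C = p} = t p)}"

definition random_cyclic :: "nat \<Rightarrow> (nat \<Rightarrow> nat) \<Rightarrow> (nat \<Rightarrow> nat) pmf" where
  "random_cyclic n t = pmf_of_set (cyclic_perms n t)"

text \<open>The function \<open>i\<close> is the increasing enumeration of the subset \<open>I\<close> being counted.\<close>

definition pattern_count :: "nat \<Rightarrow> (nat \<Rightarrow> nat) \<Rightarrow> nat \<Rightarrow> (nat \<Rightarrow> nat) \<Rightarrow> nat" where
  "pattern_count r \<pi> n \<tau> =
     card {I. I \<subseteq> {1..n} \<and>
              (\<exists>i. strict_mono_on {1..r} i \<and> I = i ` {1..r} \<and>
                   (\<forall>j\<in>{1..r}. \<forall>k\<in>{1..r}. \<pi> j > \<pi> k \<longleftrightarrow> \<tau> (i j) > \<tau> (i k)))}"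

definition pattern_mean :: "nat \<Rightarrow> (nat \<Rightarrow> nat) \<Rightarrow> nat \<Rightarrow> (nat \<Rightarrow> nat) \<Rightarrow> real" where
  "pattern_mean r \<pi> n t =
     measure_pmf.expectation (random_cyclic n t) (\<lambda>\<tau>. real (pattern_count r \<pi> n \<tau>))"

definition pattern_var :: "nat \<Rightarrow> (nat \<Rightarrow> nat) \<Rightarrow> nat \<Rightarrow> (nat \<Rightarrow> nat) \<Rightarrow> real" where
  "pattern_var r \<pi> n t =
     measure_pmf.variance (random_cyclic n t) (\<lambda>\<tau>. real (pattern_count r \<pi> n \<tau>))"

text \<open>The law of the centred pattern count divided by \<open>c\<close>.\<close>

definition scaled_pattern_law ::
    "nat \<Rightarrow> (nat \<Rightarrow> nat) \<Rightarrow> nat \<Rightarrow> (nat \<Rightarrow> nat) \<Rightarrow> real \<Rightarrow> real measure" where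
  "scaled_pattern_law r \<pi> n t c =
     distr (measure_pmf (random_cyclic n t)) borel
       (\<lambda>\<tau>. (real (pattern_count r \<pi> n \<tau>) - pattern_mean r \<pi> n t) / c)"

definition kolmogorov_dist :: "real measure \<Rightarrow> real measure \<Rightarrow> real" where
  "kolmogorov_dist M N = (SUP x. \<bar>cdf M x - cdf N x\<bar>)"

text \<open>
  The centred Gaussian law with standard deviation (not variance) \<open>\<sigma>\<close>.  The case \<open>\<sigma> = 0\<close>
  has to be treated apart because \<open>normal_density 0 0\<close> is identically zero.
\<close>

definition centred_gaussian :: "real \<Rightarrow> real measure" where
  "centred_gaussian \<sigma> =
     (if \<sigma> = 0 then return borel 0 else density lborel (\<lambda>x. ennreal (normal_density 0 \<sigma> x)))"

end

theory Submission
  imports Defs "HOL-Real_Asymp.Real_Asymp"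
begin

text \<open>
  A uniformly random \<open>t\<close>-cyclic permutation is \<open>\<rho> \<sigma> \<rho>\<inverse>\<close>, where \<open>\<sigma>\<close> is any fixed
  \<open>t\<close>-cyclic permutation and \<open>\<rho>\<close> is uniform on all permutations, and a uniform \<open>\<rho>\<close> is the rank vector
  of independent identically distributed labels \<open>u 1, ..., u n\<close> without ties.  The permutation
  \<open>\<rho> \<sigma> \<rho>\<inverse>\<close> is then the relative order of the planar points \<open>(u k, u (\<sigma> k))\<close>, and its pattern count is
  \<open>label_count\<close>: the number of sets of \<open>r\<close> points that form the pattern.  So the pattern count is a
  function \<open>f\<close> of \<open>n\<close> independent coordinates.  One label belongs to at most two of the points; with
  \<open>M = n ^ (r - 1) / (r - 1)!\<close>, changing it moves \<open>f\<close> by at most \<open>2 * M\<close>, and the mixed second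
  difference in two labels \<open>i\<close>, \<open>j\<close> is at most \<open>8 * (r - 1) * M / n\<close> unless
  \<open>i\<close> is one of \<open>j\<close>, \<open>\<sigma> j\<close>, \<open>\<sigma>\<inverse> j\<close>.

  The normal approximation of such an \<open>f\<close> is Stein's method (\<open>stein_kolmogorov_bound\<close>).  Let \<open>y\<close> be an
  independent copy of the coordinates \<open>x\<close>, \<open>D\<^sub>i\<close> the change of \<open>f\<close> when coordinate \<open>i\<close> is replaced
  after the coordinates before it have been replaced, and \<open>\<Delta>\<^sub>i\<close> the change when only coordinate
  \<open>i\<close> is replaced.  Exchanging \<open>x i\<close> with \<open>y i\<close> gives the covariance formula
  \<open>Cov (f, g) = 1/2 * (\<Sum>i. E (D\<^sub>i * \<Delta>\<^sub>i g))\<close>.  For the solution \<open>g\<close> of the Stein equation of a half line,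
  \<open>\<Delta>\<^sub>i g\<close> is \<open>\<Delta>\<^sub>i * g'\<close> up to an error that the same exchange argument controls, because \<open>g'\<close> is a
  constant plus a sum of two monotone functions.  The Kolmogorov distance of the normalised \<open>f\<close> to the
  Gaussian law is thereby at most \<open>1 / Var f\<close> times the sum of the mean absolute deviations of the conditional expectations of
  \<open>1/2 * (\<Sum>i. D\<^sub>i * \<Delta>\<^sub>i)\<close> and \<open>\<Sum>i. \<bar>D\<^sub>i\<bar> * \<Delta>\<^sub>i\<close> given \<open>x\<close>.  The covariance formula with \<open>g = f\<close> is also a
  variance bound of Efron-Stein type, and it bounds both deviations in terms of first and second
  differences (\<open>kolmogorov_bound_by_differences\<close>).  For the pattern count this gives
  \<open>42 * r * M\<^sup>2 * sqrt n / Var f\<close>, which is the first summand of the claimed bound; the second is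
  nonnegative.

  To keep every expectation a finite average, the labels are drawn from \<open>{0..<N}\<close>.  Conditionally on
  having no ties they produce exactly the uniform permutation, and \<open>N \<rightarrow> \<infinity>\<close> removes the ties
  (\<open>avg_ties_vanish\<close>).  The limit theorem follows from the bound when the limiting variance is positive
  and from Chebyshev's inequality when it is zero.
\<close>

section \<open>The standard Gaussian distribution function\<close>

abbreviation (input) gauss_pdf :: "real \<Rightarrow> real" where "gauss_pdf \<equiv> std_normal_density"
abbreviation (input) gauss_cdf :: "real \<Rightarrow> real" where "gauss_cdf \<equiv> cdf std_normal_distribution"

lemma gauss_pdf_deriv: "(gauss_pdf has_real_derivative - x * gauss_pdf x) (at x)"
  unfolding std_normal_density_def
  by (auto intro!: derivative_eq_intros simp: field_simps)

lemma gauss_pdf_minus: "gauss_pdf (- x) = gauss_pdf x"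
  by (simp add: std_normal_density_def)

lemma gauss_pdf_pos: "gauss_pdf x > 0"
  by (simp add: normal_density_pos)

lemma gauss_pdf_at_bot: "(gauss_pdf \<longlongrightarrow> 0) at_bot"
  unfolding std_normal_density_def by real_asymp

lemma gauss_cdf_diff:
  assumes "a \<le> b"
  shows "gauss_cdf b - gauss_cdf a = integral {a..b} gauss_pdf"
proof -
  interpret real_distribution std_normal_distribution by (rule real_dist_normal_dist)
  have "gauss_cdf b - gauss_cdf a = measure std_normal_distribution {a<..b}"
    using assms by (cases "a = b") (auto simp: cdf_diff_eq)
  also have "\<dots> = (LINT x:{a<..b}|lborel. gauss_pdf x)"
    by (simp add: measure_def emeasure_density set_lebesgue_integral_def integral_eq_nn_integral
        ennreal_mult' ennreal_indicator mult.commute)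
  also have "\<dots> = integral {a..b} gauss_pdf"
  proof (subst set_borel_integral_eq_integral)
    have "integrable lborel gauss_pdf" by simp
    then show "set_integrable lborel {a<..b} gauss_pdf"
      unfolding set_integrable_def by (intro integrable_mult_indicator) auto
    have "{a..b} - {a<..b} \<subseteq> {a}" by auto
    then show "integral {a<..b} gauss_pdf = integral {a..b} gauss_pdf"
      by (intro integral_subset_negligible) (auto intro: negligible_subset[of "{a}"])
  qed
  finally show ?thesis .
qed

lemma gauss_cdf_deriv: "(gauss_cdf has_real_derivative gauss_pdf x) (at x)"
proof -
  have cont: "continuous_on {x-1..x+1} gauss_pdf"
    by (intro continuous_at_imp_continuous_on ballI DERIV_isCont[OF gauss_pdf_deriv])
  have "((\<lambda>u. integral {x-1..u} gauss_pdf) has_real_derivative gauss_pdf x) (at x within {x-1..x+1})"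
    by (rule integral_has_real_derivative[OF cont]) auto
  then have "((\<lambda>u. integral {x-1..u} gauss_pdf) has_real_derivative gauss_pdf x) (at x)"
    by (simp add: at_within_Icc_at)
  then have d: "((\<lambda>u. gauss_cdf (x-1) + integral {x-1..u} gauss_pdf) has_real_derivative gauss_pdf x) (at x)"
    by (auto intro!: derivative_eq_intros)
  show ?thesis
    by (rule has_field_derivative_transform_within[OF d, of 1])
      (auto simp: dist_real_def gauss_cdf_diff[symmetric])
qed

lemma gauss_cdf_at_bot: "(gauss_cdf \<longlongrightarrow> 0) at_bot"
proof -
  interpret real_distribution std_normal_distribution by (rule real_dist_normal_dist)
  show ?thesis by (rule cdf_lim_at_bot)
qed

lemma gauss_cdf_at_top: "(gauss_cdf \<longlongrightarrow> 1) at_top"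
proof -
  interpret real_distribution std_normal_distribution by (rule real_dist_normal_dist)
  show ?thesis by (rule cdf_lim_at_top_prob)
qed

lemma gauss_cdf_minus: "gauss_cdf (- x) = 1 - gauss_cdf x"
proof -
  have d: "((\<lambda>x. gauss_cdf x + gauss_cdf (- x)) has_real_derivative 0) (at x)" for x
  proof -
    have "((\<lambda>x. gauss_cdf (- x)) has_real_derivative gauss_pdf (- x) * (- 1)) (at x)"
      by (rule DERIV_chain2[OF gauss_cdf_deriv]) (auto intro!: derivative_eq_intros)
    from DERIV_add[OF gauss_cdf_deriv this] show ?thesis by (simp add: gauss_pdf_minus)
  qed
  then have c: "gauss_cdf y + gauss_cdf (- y) = gauss_cdf x + gauss_cdf (- x)" for y
    using DERIV_isconst_all[OF allI[OF d], of y x] by simp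
  have "((\<lambda>y. gauss_cdf y + gauss_cdf (- y)) \<longlongrightarrow> 1 + 0) at_top"
    by (intro tendsto_add gauss_cdf_at_top filterlim_compose[OF gauss_cdf_at_bot] filterlim_uminus_at_bot_at_top)
  then have "((\<lambda>y. gauss_cdf x + gauss_cdf (- x)) \<longlongrightarrow> 1) (at_top :: real filter)"
    by (auto intro: Lim_transform_eventually[OF _ always_eventually[OF allI[OF c]]])
  then have "gauss_cdf x + gauss_cdf (- x) = 1"
    by (simp add: tendsto_const_iff)
  then show ?thesis by simp
qed

lemma gauss_cdf_pos: "gauss_cdf x > 0"
proof (rule DERIV_pos_imp_increasing_at_bot[OF _ gauss_cdf_at_bot])
qed (use gauss_cdf_deriv gauss_pdf_pos in blast)

lemma gauss_cdf_less_1: "gauss_cdf x < 1"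
  using gauss_cdf_pos[of "- x"] by (simp add: gauss_cdf_minus)

text \<open>
  The function \<open>\<Phi> w + \<phi> w / w\<close> vanishes at \<open>-\<infinity>\<close> and has derivative \<open>- \<phi> w / w\<^sup>2\<close>, so it is negative on the
  negative half line.
\<close>

lemma mills_upper: "- (x * gauss_cdf x) \<le> gauss_pdf x"
proof (cases "x < 0")
  case True
  let ?B = "\<lambda>w. - (gauss_cdf w + gauss_pdf w / w)"
  have "0 < ?B x"
  proof (rule DERIV_pos_imp_increasing_at_bot[of x ?B])
    show "\<exists>y. (?B has_real_derivative y) (at w) \<and> 0 < y" if "w \<le> x" for w
    proof (intro exI conjI)
      show "(?B has_real_derivative gauss_pdf w / w\<^sup>2) (at w)"
        using that True
        by (auto intro!: derivative_eq_intros gauss_cdf_deriv gauss_pdf_deriv simp: field_simps power2_eq_square)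
      show "0 < gauss_pdf w / w\<^sup>2"
        using that True gauss_pdf_pos by auto
    qed
    have "((\<lambda>w::real. 1 / w) \<longlongrightarrow> 0) at_bot" by real_asymp
    from tendsto_minus[OF tendsto_add[OF gauss_cdf_at_bot tendsto_mult[OF gauss_pdf_at_bot this]]]
    show "(?B \<longlongrightarrow> 0) at_bot" by simp
  qed
  then show ?thesis using True by (simp add: field_simps)
next
  case False
  then have "0 \<le> x * gauss_cdf x" using gauss_cdf_pos[of x] by simp
  then show ?thesis using gauss_pdf_pos[of x] by simp
qed

text \<open>
  The companion bound: \<open>\<Phi> w + w * \<phi> w / (1 + w\<^sup>2)\<close> vanishes at \<open>-\<infinity>\<close> and has derivative
  \<open>2 * \<phi> w / (1 + w\<^sup>2)\<^sup>2\<close>, so it is positive everywhere.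
\<close>

lemma mills_lower: "0 \<le> (1 + x\<^sup>2) * gauss_cdf x + x * gauss_pdf x"
proof -
  let ?C = "\<lambda>w. gauss_cdf w + w * gauss_pdf w / (1 + w\<^sup>2)"
  have nz: "1 + w\<^sup>2 \<noteq> 0" for w :: real using zero_le_power2[of w] by linarith
  have "0 < ?C x"
  proof (rule DERIV_pos_imp_increasing_at_bot[of x ?C])
    show "\<exists>y. (?C has_real_derivative y) (at w) \<and> 0 < y" for w
    proof (intro exI conjI)
      have "gauss_pdf w + ((w * (- w * gauss_pdf w) + 1 * gauss_pdf w) * (1 + w\<^sup>2) - w * gauss_pdf w * (2 * w)) / ((1 + w\<^sup>2) * (1 + w\<^sup>2))
        = 2 * gauss_pdf w / (1 + w\<^sup>2)\<^sup>2"
        using nz[of w] by (simp add: divide_simps) (simp add: algebra_simps power2_eq_square)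
      moreover have "(?C has_real_derivative gauss_pdf w + ((w * (- w * gauss_pdf w) + 1 * gauss_pdf w) * (1 + w\<^sup>2) - w * gauss_pdf w * (2 * w)) / ((1 + w\<^sup>2) * (1 + w\<^sup>2))) (at w)"
        using nz[of w] by (auto intro!: derivative_eq_intros gauss_cdf_deriv gauss_pdf_deriv)
      ultimately show "(?C has_real_derivative 2 * gauss_pdf w / (1 + w\<^sup>2)\<^sup>2) (at w)" by simp
      show "0 < 2 * gauss_pdf w / (1 + w\<^sup>2)\<^sup>2"
        using gauss_pdf_pos[of w] nz[of w] by auto
    qed
    have "((\<lambda>w::real. w / (1 + w\<^sup>2)) \<longlongrightarrow> 0) at_bot" by real_asymp
    from tendsto_add[OF gauss_cdf_at_bot tendsto_mult[OF this gauss_pdf_at_bot]]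
    show "(?C \<longlongrightarrow> 0) at_bot" by simp
  qed
  then have "0 \<le> ?C x * (1 + x\<^sup>2)" by simp
  also have "\<dots> = (1 + x\<^sup>2) * gauss_cdf x + x * gauss_pdf x"
    using nz[of x] by (simp add: field_simps)
  finally show ?thesis .
qed

section \<open>The Stein equation of a half line\<close>

definition gauss_ratio :: "real \<Rightarrow> real" where
  "gauss_ratio w = gauss_cdf w / gauss_pdf w"

lemma gauss_ratio_deriv: "(gauss_ratio has_real_derivative 1 + w * gauss_ratio w) (at w)"
proof -
  have "((\<lambda>w. gauss_cdf w / gauss_pdf w) has_real_derivative
      (gauss_pdf w * gauss_pdf w - gauss_cdf w * (- w * gauss_pdf w)) / (gauss_pdf w * gauss_pdf w)) (at w)"
    by (rule DERIV_divide[OF gauss_cdf_deriv gauss_pdf_deriv]) (use gauss_pdf_pos[of w] in simp)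
  also have "(gauss_pdf w * gauss_pdf w - gauss_cdf w * (- w * gauss_pdf w)) / (gauss_pdf w * gauss_pdf w)
     = 1 + w * gauss_ratio w"
    using gauss_pdf_pos[of w] by (simp add: gauss_ratio_def field_simps)
  finally show ?thesis unfolding gauss_ratio_def[abs_def] .
qed

text \<open>
  The derivative of \<open>w * \<Phi> w / \<phi> w\<close> is the expression of \<open>mills_lower\<close> divided by \<open>\<phi> w\<close>.
\<close>

lemma id_times_gauss_ratio_mono:
  assumes "v \<le> w"
  shows "v * gauss_ratio v \<le> w * gauss_ratio w"
proof (rule DERIV_nonneg_imp_nondecreasing[OF assms])
  show "\<exists>y. ((\<lambda>w. w * gauss_ratio w) has_real_derivative y) (at x) \<and> 0 \<le> y" for x
  proof (intro exI conjI)
    show "((\<lambda>w. w * gauss_ratio w) has_real_derivative (1 * gauss_ratio x + (1 + x * gauss_ratio x) * x)) (at x)"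
      by (intro DERIV_mult gauss_ratio_deriv DERIV_ident)
    have "0 \<le> ((1 + x\<^sup>2) * gauss_cdf x + x * gauss_pdf x) / gauss_pdf x"
      using mills_lower[of x] gauss_pdf_pos[of x] by simp
    also have "\<dots> = 1 * gauss_ratio x + (1 + x * gauss_ratio x) * x"
      using gauss_pdf_pos[of x] by (simp add: gauss_ratio_def field_simps power2_eq_square)
    finally show "0 \<le> 1 * gauss_ratio x + (1 + x * gauss_ratio x) * x" .
  qed
qed

lemma id_times_gauss_ratio_ge: "w * gauss_ratio w \<ge> -1"
  using mills_upper[of w] gauss_pdf_pos[of w] by (simp add: gauss_ratio_def field_simps)

text \<open>
  The bounded solution \<open>g\<close> of \<open>g' w = w * g w + indicator {..z} w - \<Phi> z\<close>.  The right branch is written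
  with \<open>\<Phi> (- w) = 1 - \<Phi> w\<close>, so that both branches are handled by the one function \<open>gauss_ratio\<close>.
\<close>

definition stein_sol :: "real \<Rightarrow> real \<Rightarrow> real" where
  "stein_sol z w = (if w \<le> z then (1 - gauss_cdf z) * gauss_ratio w else gauss_cdf z * gauss_ratio (- w))"

lemma stein_sol_right: "z \<le> w \<Longrightarrow> stein_sol z w = gauss_cdf z * gauss_ratio (- w)"
  by (auto simp: stein_sol_def gauss_ratio_def gauss_cdf_minus gauss_pdf_minus)

lemma id_times_stein_sol_mono:
  assumes "v \<le> w"
  shows "v * stein_sol z v \<le> w * stein_sol z w"
proof -
  have left: "v * stein_sol z v \<le> w * stein_sol z w" if "v \<le> w" "w \<le> z" for v w
    using mult_left_mono[OF id_times_gauss_ratio_mono[OF that(1)], of "1 - gauss_cdf z"] that gauss_cdf_less_1[of z]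
    by (simp add: stein_sol_def algebra_simps)
  have right: "v * stein_sol z v \<le> w * stein_sol z w" if "v \<le> w" "z \<le> v" for v w
    using mult_left_mono[OF id_times_gauss_ratio_mono[of "-w" "-v"], of "gauss_cdf z"] that gauss_cdf_pos[of z]
    by (simp add: stein_sol_right algebra_simps)
  consider "w \<le> z" | "z \<le> v" | "v \<le> z" "z \<le> w" by linarith
  then show ?thesis
    using left[of v w] right[of v w] left[of v z] right[of z w] assms by cases auto
qed

text \<open>
  As \<open>w * g w\<close> increases, its values lie between its limits \<open>\<Phi> z - 1\<close> at \<open>-\<infinity>\<close> and \<open>\<Phi> z\<close> at \<open>\<infinity>\<close>.  This
  confines both summands of \<open>g'\<close> to intervals of length 1.
\<close>

lemma id_times_stein_sol_ge: "- (1 - gauss_cdf z) \<le> w * stein_sol z w"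
proof (cases "w \<le> z")
  case True
  then show ?thesis
    using mult_left_mono[OF id_times_gauss_ratio_ge[of w], of "1 - gauss_cdf z"] gauss_cdf_less_1[of z]
    by (simp add: stein_sol_def algebra_simps)
next
  case False
  have "- (1 - gauss_cdf z) \<le> z * stein_sol z z"
    using mult_left_mono[OF id_times_gauss_ratio_ge[of z], of "1 - gauss_cdf z"] gauss_cdf_less_1[of z]
    by (simp add: stein_sol_def algebra_simps)
  also have "\<dots> \<le> w * stein_sol z w" using False by (intro id_times_stein_sol_mono) simp
  finally show ?thesis .
qed

lemma id_times_stein_sol_le: "w * stein_sol z w \<le> gauss_cdf z"
proof -
  have *: "w * stein_sol z w \<le> gauss_cdf z" if "z \<le> w" for w
    using mult_left_mono[OF id_times_gauss_ratio_ge[of "-w"], of "gauss_cdf z"] gauss_cdf_pos[of z] that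
    by (simp add: stein_sol_right algebra_simps)
  show ?thesis
    using *[of w] order_trans[OF id_times_stein_sol_mono *[of z], of w] by (cases "w \<le> z") auto
qed

text \<open>
  The derivative of \<open>stein_sol z\<close>, with the left derivative chosen at the kink \<open>z\<close>.
\<close>

definition stein_slope :: "real \<Rightarrow> real \<Rightarrow> real" where
  "stein_slope z w = w * stein_sol z w + indicator {..z} w - gauss_cdf z"

text \<open>
  The two nonconstant summands of the slope are monotone in opposite directions; their difference is
  increasing and dominates the oscillation of the slope.
\<close>

definition stein_gap :: "real \<Rightarrow> real \<Rightarrow> real" where
  "stein_gap z w = w * stein_sol z w - indicator {..z} w"

lemma abs_stein_slope_le_1: "\<bar>stein_slope z w\<bar> \<le> 1"
  using id_times_stein_sol_ge[of z w] id_times_stein_sol_le[of w z]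
    gauss_cdf_pos[of z] gauss_cdf_less_1[of z]
  by (cases "w \<le> z") (auto simp: stein_slope_def)

text \<open>
  The shift by \<open>1 - \<Phi> z\<close> centres the range of the gap, which has length 2.  It is harmless later because the
  gap is integrated against a function of mean zero.
\<close>

lemma abs_stein_gap_le_1: "\<bar>stein_gap z w + 1 - gauss_cdf z\<bar> \<le> 1"
  using id_times_stein_sol_ge[of z w] id_times_stein_sol_le[of w z]
    gauss_cdf_pos[of z] gauss_cdf_less_1[of z]
  by (cases "w \<le> z") (auto simp: stein_gap_def)

lemma stein_sol_increment_left:
  assumes "v \<le> w" "w \<le> z"
  shows "(w - v) * (v * stein_sol z v + 1 - gauss_cdf z) \<le> stein_sol z w - stein_sol z v"
    "stein_sol z w - stein_sol z v \<le> (w - v) * (w * stein_sol z w + 1 - gauss_cdf z)"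
proof -
  have "\<exists>u\<in>{v..w}. stein_sol z w - stein_sol z v = (w - v) * (u * stein_sol z u + 1 - gauss_cdf z)"
  proof (cases "v = w")
    case False
    then have "v < w" using assms by simp
    have "\<exists>u>v. u < w \<and> (1 - gauss_cdf z) * gauss_ratio w - (1 - gauss_cdf z) * gauss_ratio v
        = (w - v) * ((1 - gauss_cdf z) * (1 + u * gauss_ratio u))"
      by (rule MVT2[OF \<open>v < w\<close>]) (intro DERIV_cmult gauss_ratio_deriv)
    then obtain u where "v < u" "u < w" "(1 - gauss_cdf z) * gauss_ratio w - (1 - gauss_cdf z) * gauss_ratio v
        = (w - v) * ((1 - gauss_cdf z) * (1 + u * gauss_ratio u))" by blast
    then show ?thesis using assms by (intro bexI[of _ u]) (auto simp: stein_sol_def algebra_simps)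
  qed auto
  then obtain u where u: "u \<in> {v..w}" "stein_sol z w - stein_sol z v = (w - v) * (u * stein_sol z u + 1 - gauss_cdf z)"
    by blast
  show "(w - v) * (v * stein_sol z v + 1 - gauss_cdf z) \<le> stein_sol z w - stein_sol z v"
    using u assms id_times_stein_sol_mono[of v u z] by (auto intro!: mult_left_mono)
  show "stein_sol z w - stein_sol z v \<le> (w - v) * (w * stein_sol z w + 1 - gauss_cdf z)"
    using u assms id_times_stein_sol_mono[of u w z] by (auto intro!: mult_left_mono)
qed

lemma stein_sol_increment_right:
  assumes "v \<le> w" "z \<le> v"
  shows "(w - v) * (v * stein_sol z v - gauss_cdf z) \<le> stein_sol z w - stein_sol z v"
    "stein_sol z w - stein_sol z v \<le> (w - v) * (w * stein_sol z w - gauss_cdf z)"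
proof -
  have "\<exists>u\<in>{v..w}. stein_sol z w - stein_sol z v = (w - v) * (u * stein_sol z u - gauss_cdf z)"
  proof (cases "v = w")
    case False
    then have "v < w" using assms by simp
    have d: "((\<lambda>u. gauss_cdf z * gauss_ratio (- u)) has_real_derivative gauss_cdf z * ((1 + (- u) * gauss_ratio (- u)) * (- 1))) (at u)" for u
      by (intro DERIV_cmult DERIV_chain2[OF gauss_ratio_deriv]) (auto intro!: derivative_eq_intros)
    have "\<exists>u>v. u < w \<and> gauss_cdf z * gauss_ratio (- w) - gauss_cdf z * gauss_ratio (- v)
        = (w - v) * (gauss_cdf z * ((1 + (- u) * gauss_ratio (- u)) * (- 1)))"
      by (rule MVT2[OF \<open>v < w\<close>]) (rule d)
    then obtain u where "v < u" "u < w" "gauss_cdf z * gauss_ratio (- w) - gauss_cdf z * gauss_ratio (- v)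
        = (w - v) * (gauss_cdf z * ((1 + (- u) * gauss_ratio (- u)) * (- 1)))" by blast
    then show ?thesis using assms by (intro bexI[of _ u]) (auto simp: stein_sol_right algebra_simps)
  qed auto
  then obtain u where u: "u \<in> {v..w}" "stein_sol z w - stein_sol z v = (w - v) * (u * stein_sol z u - gauss_cdf z)"
    by blast
  show "(w - v) * (v * stein_sol z v - gauss_cdf z) \<le> stein_sol z w - stein_sol z v"
    using u assms id_times_stein_sol_mono[of v u z] by (auto intro!: mult_left_mono)
  show "stein_sol z w - stein_sol z v \<le> (w - v) * (w * stein_sol z w - gauss_cdf z)"
    using u assms id_times_stein_sol_mono[of u w z] by (auto intro!: mult_left_mono)
qed

text \<open>
  An increment is the interval length times a value of \<open>g'\<close> inside the interval, and that value is
  estimated by bounding each of the two monotone summands at the worse endpoint.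
\<close>

lemma stein_sol_increment:
  assumes "v \<le> w"
  shows "(w - v) * (v * stein_sol z v + indicator {..z} w - gauss_cdf z) \<le> stein_sol z w - stein_sol z v"
    "stein_sol z w - stein_sol z v \<le> (w - v) * (w * stein_sol z w + indicator {..z} v - gauss_cdf z)"
proof -
  consider "w \<le> z" | "z < v" | "v \<le> z" "z < w" by linarith
  then have "(w - v) * (v * stein_sol z v + indicator {..z} w - gauss_cdf z) \<le> stein_sol z w - stein_sol z v
    \<and> stein_sol z w - stein_sol z v \<le> (w - v) * (w * stein_sol z w + indicator {..z} v - gauss_cdf z)"
  proof cases
    case 1
    then show ?thesis using stein_sol_increment_left[OF assms] assms by simp
  next
    case 2
    then show ?thesis using stein_sol_increment_right[OF assms] assms by simp
  next
    case 3
    note l = stein_sol_increment_left[OF 3(1) order_refl]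
    note r = stein_sol_increment_right[OF less_imp_le[OF 3(2)] order_refl]
    have a: "(z - v) * (v * stein_sol z v) \<le> (z - v) * (v * stein_sol z v + 1)"
      "(w - z) * (v * stein_sol z v) \<le> (w - z) * (z * stein_sol z z)"
      "(z - v) * (z * stein_sol z z) \<le> (z - v) * (w * stein_sol z w)"
      "(w - z) * (w * stein_sol z w) \<le> (w - z) * (w * stein_sol z w + 1)"
      using 3 id_times_stein_sol_mono[of v z z] id_times_stein_sol_mono[of z w z] by (auto intro!: mult_left_mono)
    show ?thesis using l r a 3 by (auto simp: algebra_simps)
  qed
  then show "(w - v) * (v * stein_sol z v + indicator {..z} w - gauss_cdf z) \<le> stein_sol z w - stein_sol z v"
    "stein_sol z w - stein_sol z v \<le> (w - v) * (w * stein_sol z w + indicator {..z} v - gauss_cdf z)"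
    by auto
qed

text \<open>
  First-order expansion of \<open>g\<close> with an error of the form \<open>(w - v) * (k w - k v)\<close> for an increasing \<open>k\<close>.
  Being a difference of values of \<open>k\<close>, and not merely a square of \<open>w - v\<close>, the error can be treated by
  exchangeability although \<open>g'\<close> jumps.
\<close>

lemma stein_sol_taylor:
  "\<bar>stein_sol z w - stein_sol z v - (w - v) * stein_slope z w\<bar> \<le> (w - v) * (stein_gap z w - stein_gap z v)"
proof (cases "v \<le> w")
  case True
  let ?m = "\<lambda>w. w * stein_sol z w" and ?h = "indicator {..z} :: real \<Rightarrow> real"
  have "0 \<le> (w - v) * (?m w - ?m v)" "0 \<le> (w - v) * (?h v - ?h w)"
    using True id_times_stein_sol_mono[OF True, of z] by (auto intro!: mult_nonneg_nonneg simp: indicator_def)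
  then show ?thesis
    using stein_sol_increment[OF True, of z] unfolding stein_slope_def stein_gap_def abs_le_iff
    by (simp add: algebra_simps)
next
  case False
  then have True: "w \<le> v" by simp
  let ?m = "\<lambda>w. w * stein_sol z w" and ?h = "indicator {..z} :: real \<Rightarrow> real"
  have "0 \<le> (v - w) * (?m v - ?m w)" "0 \<le> (v - w) * (?h w - ?h v)"
    using True id_times_stein_sol_mono[OF True, of z] by (auto intro!: mult_nonneg_nonneg simp: indicator_def)
  then show ?thesis
    using stein_sol_increment[OF True, of z] unfolding stein_slope_def stein_gap_def abs_le_iff
    by (simp add: algebra_simps)
qed

section \<open>Averages over finite sets\<close>

definition avg :: "'a set \<Rightarrow> ('a \<Rightarrow> real) \<Rightarrow> real" where
  "avg A F = (\<Sum>x\<in>A. F x) / card A"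

lemma avg_add: "avg A (\<lambda>x. F x + G x) = avg A F + avg A G"
  by (simp add: avg_def sum.distrib add_divide_distrib)

lemma avg_diff: "avg A (\<lambda>x. F x - G x) = avg A F - avg A G"
  by (simp add: avg_def sum_subtractf diff_divide_distrib)

lemma avg_minus: "avg A (\<lambda>x. - F x) = - avg A F"
  by (simp add: avg_def sum_negf)

lemma avg_cmult: "avg A (\<lambda>x. c * F x) = c * avg A F"
  by (simp add: avg_def sum_distrib_left)

lemma avg_mult_const: "avg A (\<lambda>x. F x * c) = avg A F * c"
  by (simp add: avg_def sum_distrib_right)

lemma avg_divide: "avg A (\<lambda>x. F x / c) = avg A F / c"
  by (simp add: avg_def sum_divide_distrib mult.commute)

lemma avg_sum: "avg A (\<lambda>x. \<Sum>i\<in>I. F i x) = (\<Sum>i\<in>I. avg A (F i))"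
  unfolding avg_def by (subst sum.swap) (simp add: sum_divide_distrib)

lemma avg_const: "finite A \<Longrightarrow> A \<noteq> {} \<Longrightarrow> avg A (\<lambda>_. c) = c"
  by (simp add: avg_def)

lemma avg_cong: "(\<And>x. x \<in> A \<Longrightarrow> F x = G x) \<Longrightarrow> avg A F = avg A G"
  by (simp add: avg_def)

lemma avg_mono: "(\<And>x. x \<in> A \<Longrightarrow> F x \<le> G x) \<Longrightarrow> avg A F \<le> avg A G"
  unfolding avg_def by (intro divide_right_mono sum_mono) auto

lemma abs_avg_le: "\<bar>avg A F\<bar> \<le> avg A (\<lambda>x. \<bar>F x\<bar>)"
  unfolding avg_def by (simp add: divide_right_mono)

lemma avg_bij: "bij_betw h A B \<Longrightarrow> avg B F = avg A (\<lambda>x. F (h x))"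
  using sum.reindex_bij_betw[of h A B F] bij_betw_same_card[of h A B] by (simp add: avg_def)

lemma avg_times: "avg (A \<times> B) (\<lambda>(x, y). F x y) = avg A (\<lambda>x. avg B (F x))"
  by (simp add: avg_def sum.cartesian_product[symmetric] sum_divide_distrib card_cartesian_product field_simps)

lemma avg_swap: "avg A (\<lambda>x. avg B (F x)) = avg B (\<lambda>y. avg A (\<lambda>x. F x y))"
  unfolding avg_def sum_divide_distrib[symmetric] by (subst sum.swap) (simp add: mult.commute)

lemma square_avg_le: "(avg A F)\<^sup>2 \<le> avg A (\<lambda>x. (F x)\<^sup>2)"
proof (cases "card A = 0")
  case False
  then show ?thesis using sum_squared_le_sum_of_squares[of F A]
    by (simp add: avg_def power_divide power2_eq_square divide_simps algebra_simps)
qed (simp add: avg_def)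

lemma avg_centred_square:
  assumes "finite A" "A \<noteq> {}"
  shows "avg A (\<lambda>x. (F x - avg A F)\<^sup>2) = avg A (\<lambda>x. (F x)\<^sup>2) - (avg A F)\<^sup>2"
proof -
  have "avg A (\<lambda>x. (F x - avg A F)\<^sup>2) = avg A (\<lambda>x. (F x)\<^sup>2 - (2 * avg A F) * F x + (avg A F)\<^sup>2)"
    by (simp add: power2_diff algebra_simps)
  also have "\<dots> = avg A (\<lambda>x. (F x)\<^sup>2) - (avg A F)\<^sup>2"
    unfolding avg_add avg_diff avg_cmult using avg_const[OF assms] by (simp add: power2_eq_square)
  finally show ?thesis .
qed

section \<open>A covariance formula for independent coordinates\<close>

text \<open>
  The path from \<open>x\<close> to \<open>y\<close> that replaces the coordinates one at a time, in increasing order.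
\<close>

definition hybrid :: "nat \<Rightarrow> (nat \<Rightarrow> 'a) \<Rightarrow> (nat \<Rightarrow> 'a) \<Rightarrow> nat \<Rightarrow> 'a" where
  "hybrid i x y = (\<lambda>k. if k \<le> i then y k else x k)"

definition path_diff :: "((nat \<Rightarrow> 'a) \<Rightarrow> real) \<Rightarrow> nat \<Rightarrow> (nat \<Rightarrow> 'a) \<Rightarrow> (nat \<Rightarrow> 'a) \<Rightarrow> real" where
  "path_diff f i x y = f (hybrid (i - 1) x y) - f (hybrid i x y)"

definition single_diff :: "((nat \<Rightarrow> 'a) \<Rightarrow> real) \<Rightarrow> nat \<Rightarrow> (nat \<Rightarrow> 'a) \<Rightarrow> (nat \<Rightarrow> 'a) \<Rightarrow> real" where
  "single_diff f i x y = f x - f (x(i := y i))"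

text \<open>
  Two independent copies of \<open>n\<close> independent uniform coordinates in \<open>Om\<close>: \<open>E1\<close> is the expectation over one
  copy and \<open>E2\<close> the expectation over both.
\<close>

locale iid_coordinates =
  fixes n :: nat and Om :: "'a set"
  assumes finite_Om: "finite Om" and Om_nonempty: "Om \<noteq> {}"
begin

definition "P = ({1..n} \<rightarrow>\<^sub>E Om)"

abbreviation "E1 h \<equiv> avg P h"
abbreviation "E2 F \<equiv> avg (P \<times> P) (\<lambda>(x, y). F x y)"

lemma finite_P: "finite P" and P_nonempty: "P \<noteq> {}"
  using finite_Om Om_nonempty by (auto simp: P_def intro!: finite_PiE simp: PiE_eq_empty_iff)

lemma E2_iterated: "E2 F = E1 (\<lambda>x. E1 (F x))"
  by (rule avg_times)

lemma E1_const: "E1 (\<lambda>_. c) = c"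
  using finite_P P_nonempty by (rule avg_const)

lemma upd_P: "x \<in> P \<Longrightarrow> i \<in> {1..n} \<Longrightarrow> a \<in> Om \<Longrightarrow> x(i := a) \<in> P"
  unfolding P_def by (auto simp: PiE_iff extensional_def)

lemma P_Om: "x \<in> P \<Longrightarrow> i \<in> {1..n} \<Longrightarrow> x i \<in> Om"
  by (auto simp: P_def)

lemma P_undefined: "x \<in> P \<Longrightarrow> i \<notin> {1..n} \<Longrightarrow> x i = undefined"
  unfolding P_def by (rule PiE_arb)

lemma hybrid_P: "x \<in> P \<Longrightarrow> y \<in> P \<Longrightarrow> hybrid i x y \<in> P"
  by (auto simp: P_def hybrid_def PiE_iff extensional_def)

text \<open>
  The path really starts at \<open>x\<close> and ends at \<open>y\<close>, because elements of the product agree outside \<open>{1..n}\<close>.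
\<close>

lemma hybrid_0: "x \<in> P \<Longrightarrow> y \<in> P \<Longrightarrow> hybrid 0 x y = x"
  using P_undefined[of x 0] P_undefined[of y 0] by (auto simp: hybrid_def)

lemma hybrid_n: "x \<in> P \<Longrightarrow> y \<in> P \<Longrightarrow> hybrid n x y = y"
proof
  fix k assume "x \<in> P" "y \<in> P"
  then show "hybrid n x y k = y k" using P_undefined[of x k] P_undefined[of y k] by (auto simp: hybrid_def)
qed

lemma hybrid_step: "i \<ge> 1 \<Longrightarrow> hybrid i x y = (hybrid (i - 1) x y)(i := y i)"
  by (auto simp: hybrid_def fun_eq_iff)

lemma path_diff_eq:
  "i \<ge> 1 \<Longrightarrow> path_diff f i x y = single_diff f i (hybrid (i - 1) x y) y"
  using hybrid_step[of i x y] by (simp add: path_diff_def single_diff_def)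

lemma E2_swap:
  assumes "i \<in> {1..n}"
  shows "E2 F = E2 (\<lambda>x y. F (x(i := y i)) (y(i := x i)))"
proof -
  have "bij_betw (\<lambda>(x, y). (x(i := y i), y(i := x i))) (P \<times> P) (P \<times> P)"
    by (rule bij_betwI[where g = "\<lambda>(x, y). (x(i := y i), y(i := x i))"])
      (use assms in \<open>auto intro!: upd_P P_Om\<close>)
  from avg_bij[OF this, of "\<lambda>(x, y). F x y"] show ?thesis by (simp add: case_prod_beta')
qed

text \<open>
  Exchanging the \<open>i\<close>-th coordinates exchanges the two ends of the \<open>i\<close>-th step of the path.
\<close>

lemma path_diff_swap:
  "i \<ge> 1 \<Longrightarrow> path_diff f i (x(i := y i)) (y(i := x i)) = - path_diff f i x y"
proof -
  assume "i \<ge> 1"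
  then have "hybrid (i - 1) (x(i := y i)) (y(i := x i)) = hybrid i x y"
    "hybrid i (x(i := y i)) (y(i := x i)) = hybrid (i - 1) x y"
    by (auto simp: hybrid_def fun_eq_iff)
  then show ?thesis by (simp add: path_diff_def)
qed

lemma single_diff_swap: "single_diff f i (x(i := y i)) (y(i := x i)) = - single_diff f i x y"
  by (simp add: single_diff_def)

text \<open>
  The covariance is \<open>E ((f x - f y) * g x)\<close>.  Telescoping along the path writes \<open>f x - f y\<close> as a sum of steps,
  and each step changes sign under the exchange of \<open>x i\<close> with \<open>y i\<close>, so \<open>g x\<close> may be replaced by half of its
  change under that exchange.
\<close>

lemma covariance_formula:
  "E1 (\<lambda>x. f x * g x) - E1 f * E1 g
    = (\<Sum>i=1..n. E2 (\<lambda>x y. path_diff f i x y * single_diff g i x y)) / 2"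
proof -
  have "E1 (\<lambda>x. f x * g x) - E1 f * E1 g = E2 (\<lambda>x y. (f x - f y) * g x)"
    unfolding E2_iterated by (simp add: left_diff_distrib avg_diff avg_mult_const avg_cmult E1_const)
  also have "\<dots> = E2 (\<lambda>x y. \<Sum>i=1..n. path_diff f i x y * g x)"
  proof (rule avg_cong, clarify)
    fix x y assume xy: "x \<in> P" "y \<in> P"
    have "(\<Sum>i=1..n. path_diff f i x y) = f (hybrid 0 x y) - f (hybrid n x y)"
      by (induction n) (auto simp: path_diff_def)
    then show "(f x - f y) * g x = (\<Sum>i = 1..n. path_diff f i x y * g x)"
      by (simp add: hybrid_0[OF xy] hybrid_n[OF xy] sum_distrib_right[symmetric])
  qed
  also have "\<dots> = (\<Sum>i=1..n. E2 (\<lambda>x y. path_diff f i x y * g x))"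
    by (simp add: case_prod_beta' avg_sum)
  also have "\<dots> = (\<Sum>i=1..n. E2 (\<lambda>x y. path_diff f i x y * single_diff g i x y) / 2)"
  proof (rule sum.cong[OF refl])
    fix i assume i: "i \<in> {1..n}"
    have "E2 (\<lambda>x y. path_diff f i x y * g x) = E2 (\<lambda>x y. - (path_diff f i x y * g (x(i := y i))))"
      using i by (subst E2_swap[OF i]) (simp add: path_diff_swap)
    also have "\<dots> = - E2 (\<lambda>x y. path_diff f i x y * g (x(i := y i)))"
      by (simp add: case_prod_beta' avg_minus)
    finally have "2 * E2 (\<lambda>x y. path_diff f i x y * g x)
        = E2 (\<lambda>x y. path_diff f i x y * g x) - E2 (\<lambda>x y. path_diff f i x y * g (x(i := y i)))" by simp
    also have "\<dots> = E2 (\<lambda>x y. path_diff f i x y * single_diff g i x y)"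
      by (simp add: avg_diff[symmetric] case_prod_beta' single_diff_def right_diff_distrib)
    finally show "E2 (\<lambda>x y. path_diff f i x y * g x) = E2 (\<lambda>x y. path_diff f i x y * single_diff g i x y) / 2" by simp
  qed
  finally show ?thesis by (simp add: sum_divide_distrib)
qed

text \<open>
  Efron-Stein in bounded-difference form: the covariance formula with both functions equal to \<open>h\<close> gives
  \<open>Var h \<le> n * c\<^sup>2 / 2\<close>, and the mean absolute deviation is at most the standard deviation.
\<close>

lemma mean_abs_deviation_le:
  assumes "\<And>x i a. x \<in> P \<Longrightarrow> i \<in> {1..n} \<Longrightarrow> a \<in> Om \<Longrightarrow> \<bar>h x - h (x(i := a))\<bar> \<le> c"
  shows "E1 (\<lambda>x. \<bar>h x - E1 h\<bar>) \<le> sqrt (n / 2) * c"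
proof -
  have single: "\<bar>single_diff h i x y\<bar> \<le> c" if "x \<in> P" "y \<in> P" "i \<in> {1..n}" for i x y
    using assms[of x i "y i"] that P_Om by (auto simp: single_diff_def)
  have "(E1 (\<lambda>x. \<bar>h x - E1 h\<bar>))\<^sup>2 \<le> E1 (\<lambda>x. (h x - E1 h)\<^sup>2)"
    using square_avg_le[of P "\<lambda>x. \<bar>h x - E1 h\<bar>"] by simp
  also have "\<dots> = E1 (\<lambda>x. h x * h x) - E1 h * E1 h"
    using avg_centred_square[OF finite_P P_nonempty, of h] by (simp add: power2_eq_square)
  also have "\<dots> = (\<Sum>i=1..n. E2 (\<lambda>x y. path_diff h i x y * single_diff h i x y)) / 2"
    by (rule covariance_formula)
  also have "\<dots> \<le> (\<Sum>i=1..n. c\<^sup>2) / 2"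
  proof (intro divide_right_mono sum_mono)
    fix i assume i: "i \<in> {1..n}"
    have "E2 (\<lambda>x y. path_diff h i x y * single_diff h i x y) \<le> avg (P \<times> P) (\<lambda>_. c\<^sup>2)"
    proof (rule avg_mono, clarify)
      fix x y assume xy: "x \<in> P" "y \<in> P"
      have "\<bar>path_diff h i x y\<bar> * \<bar>single_diff h i x y\<bar> \<le> c * c"
        using i xy single[OF hybrid_P[OF xy] xy(2) i, of "i - 1"] single[OF xy i] by (intro mult_mono) (auto simp: path_diff_eq)
      then show "path_diff h i x y * single_diff h i x y \<le> c\<^sup>2"
        by (metis abs_le_D1 abs_mult power2_eq_square)
    qed
    also have "\<dots> = c\<^sup>2" using finite_P P_nonempty by (intro avg_const) auto
    finally show "E2 (\<lambda>x y. path_diff h i x y * single_diff h i x y) \<le> c\<^sup>2" .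
  qed simp
  also have "\<dots> = (sqrt (n / 2) * c)\<^sup>2" by (simp add: power_mult_distrib)
  finally have le: "(E1 (\<lambda>x. \<bar>h x - E1 h\<bar>))\<^sup>2 \<le> (sqrt (n / 2) * c)\<^sup>2" .
  show ?thesis
  \<comment> \<open>Without coordinates the hypothesis says nothing about the sign of \<open>c\<close>, but then both sides vanish.\<close>
  proof (cases "n = 0")
    case True
    then show ?thesis using le by simp
  next
    case False
    obtain x where x: "x \<in> P" using P_nonempty by auto
    have "c \<ge> 0" using single[OF x x, of 1] False by (auto simp: single_diff_def)
    then show ?thesis using le by (intro power2_le_imp_le[OF le]) auto
  qed
qed

section \<open>Stein's method for functions of independent coordinates\<close>

text \<open>
  Conditional expectations given \<open>x\<close>.  The first is the random coefficient that stands in for the variance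
  in Stein's identity; the second measures the first-order error of the expansion of the Stein solution.
\<close>

definition stein_kernel :: "((nat \<Rightarrow> 'a) \<Rightarrow> real) \<Rightarrow> (nat \<Rightarrow> 'a) \<Rightarrow> real" where
  "stein_kernel f x = E1 (\<lambda>y. (\<Sum>i=1..n. path_diff f i x y * single_diff f i x y) / 2)"

definition remainder_kernel :: "((nat \<Rightarrow> 'a) \<Rightarrow> real) \<Rightarrow> (nat \<Rightarrow> 'a) \<Rightarrow> real" where
  "remainder_kernel f x = E1 (\<lambda>y. \<Sum>i=1..n. \<bar>path_diff f i x y\<bar> * single_diff f i x y)"

lemma E2_sum: "E2 (\<lambda>x y. \<Sum>i\<in>I. F i x y) = (\<Sum>i\<in>I. E2 (F i))"
  by (simp add: case_prod_beta' avg_sum)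

lemma E2_mono: "(\<And>x y. x \<in> P \<Longrightarrow> y \<in> P \<Longrightarrow> F x y \<le> G x y) \<Longrightarrow> E2 F \<le> E2 G"
  by (rule avg_mono) auto

lemma E2_cmult: "E2 (\<lambda>x y. c * F x y) = c * E2 F"
  by (simp add: case_prod_beta' avg_cmult)

lemma mean_stein_kernel: "E1 (stein_kernel f) = E1 (\<lambda>x. (f x)\<^sup>2) - (E1 f)\<^sup>2"
proof -
  have "E1 (stein_kernel f) = E2 (\<lambda>x y. (\<Sum>i=1..n. path_diff f i x y * single_diff f i x y) / 2)"
    unfolding E2_iterated stein_kernel_def ..
  also have "\<dots> = E1 (\<lambda>x. f x * f x) - E1 f * E1 f"
    unfolding covariance_formula by (simp add: case_prod_beta' avg_divide avg_sum)
  finally show ?thesis by (simp add: power2_eq_square)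
qed

text \<open>
  Under the exchange of coordinate \<open>i\<close> the factor \<open>\<bar>path_diff\<bar>\<close> is invariant and \<open>single_diff\<close> changes sign,
  so the two terms of \<open>k x - k (x(i := y i))\<close> contribute equally.
\<close>

lemma symmetrised_increment:
  assumes i: "i \<in> {1..n}"
  shows "E2 (\<lambda>x y. \<bar>path_diff f i x y\<bar> * (single_diff f i x y * (k x - k (x(i := y i)))))
    = 2 * E2 (\<lambda>x y. \<bar>path_diff f i x y\<bar> * single_diff f i x y * k x)"
proof -
  have "E2 (\<lambda>x y. \<bar>path_diff f i x y\<bar> * single_diff f i x y * k x)
      = E2 (\<lambda>x y. - (\<bar>path_diff f i x y\<bar> * single_diff f i x y * k (x(i := y i))))"
    using i by (subst E2_swap[OF i]) (simp add: path_diff_swap single_diff_swap)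
  also have "\<dots> = - E2 (\<lambda>x y. \<bar>path_diff f i x y\<bar> * single_diff f i x y * k (x(i := y i)))"
    by (simp add: case_prod_beta' avg_minus)
  finally have "2 * E2 (\<lambda>x y. \<bar>path_diff f i x y\<bar> * single_diff f i x y * k x)
     = E2 (\<lambda>x y. \<bar>path_diff f i x y\<bar> * single_diff f i x y * k x)
      - E2 (\<lambda>x y. \<bar>path_diff f i x y\<bar> * single_diff f i x y * k (x(i := y i)))"
    by simp
  also have "\<dots> = E2 (\<lambda>x y. \<bar>path_diff f i x y\<bar> * (single_diff f i x y * (k x - k (x(i := y i)))))"
    by (simp add: avg_diff[symmetric] case_prod_beta' right_diff_distrib mult.assoc)
  finally show ?thesis by simp
qed

lemma remainder_kernel_weighted:
  "E1 (\<lambda>x. remainder_kernel f x * k x)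
     = (\<Sum>i=1..n. E2 (\<lambda>x y. \<bar>path_diff f i x y\<bar> * single_diff f i x y * k x))"
proof -
  have "(\<Sum>i=1..n. E2 (\<lambda>x y. \<bar>path_diff f i x y\<bar> * single_diff f i x y * k x))
      = E2 (\<lambda>x y. \<Sum>i=1..n. \<bar>path_diff f i x y\<bar> * single_diff f i x y * k x)"
    by (rule E2_sum[symmetric])
  also have "\<dots> = E1 (\<lambda>x. remainder_kernel f x * k x)"
    unfolding E2_iterated remainder_kernel_def by (simp add: avg_mult_const[symmetric] sum_distrib_right)
  finally show ?thesis ..
qed

lemma mean_remainder_kernel: "E1 (remainder_kernel f) = 0"
proof -
  have "E2 (\<lambda>x y. \<bar>path_diff f i x y\<bar> * single_diff f i x y * 1) = 0" if "i \<in> {1..n}" for i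
    using symmetrised_increment[OF that, of f "\<lambda>_. 1"]
    by (simp add: case_prod_beta' avg_def)
  then show ?thesis using remainder_kernel_weighted[of f "\<lambda>_. 1"] by simp
qed

definition Var1 :: "((nat \<Rightarrow> 'a) \<Rightarrow> real) \<Rightarrow> real" where
  "Var1 f = E1 (\<lambda>x. (f x)\<^sup>2) - (E1 f)\<^sup>2"

text \<open>
  By the Stein equation the left-hand side is \<open>E (q - W * g W)\<close> with \<open>q\<close> the slope of \<open>g\<close> at the normalised
  \<open>W\<close>.  The covariance formula turns \<open>E (W * g W)\<close> into \<open>E (T * q) / Var f\<close> plus an error, where \<open>T\<close> is
  the Stein kernel, whose mean is \<open>Var f\<close>; since \<open>\<bar>q\<bar> \<le> 1\<close>, the main term costs the mean absolute
  deviation of \<open>T\<close>.  The error is dominated by \<open>stein_sol_taylor\<close>, whose form is the one required by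
  \<open>symmetrised_increment\<close>; it becomes the integral of the remainder kernel, which has mean zero, against
  a function that is at most 1 after centring.
\<close>

theorem stein_kolmogorov_bound:
  assumes pos: "Var1 f > 0"
  shows "\<bar>E1 (\<lambda>x. indicator {..z} ((f x - E1 f) / sqrt (Var1 f))) - gauss_cdf z\<bar>
    \<le> (E1 (\<lambda>x. \<bar>stein_kernel f x - E1 (stein_kernel f)\<bar>) + E1 (\<lambda>x. \<bar>remainder_kernel f x - E1 (remainder_kernel f)\<bar>)) / Var1 f"
proof -
  define s where "s = sqrt (Var1 f)"
  have s: "s > 0" "s\<^sup>2 = Var1 f" using pos by (auto simp: s_def)
  define W where "W x = (f x - E1 f) / s" for x
  define g where "g x = stein_sol z (W x)" for x
  define q where "q x = stein_slope z (W x)" for x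
  define k where "k x = stein_gap z (W x)" for x
  \<comment> \<open>The cost of replacing the increments of \<open>g\<close> by their linear parts in the covariance of \<open>f\<close> and \<open>g\<close>.\<close>
  define err where "err = (\<Sum>i=1..n. E2 (\<lambda>x y. path_diff f i x y * (single_diff g i x y - single_diff f i x y / s * q x))) / 2"
  have W_diff: "W x - W (x(i := y i)) = single_diff f i x y / s" for x y i
    by (simp add: W_def single_diff_def diff_divide_distrib)
  have "E1 (\<lambda>x. q x) = E1 (\<lambda>x. (f x * g x - E1 f * g x) / s + indicator {..z} (W x) - gauss_cdf z)"
    by (simp add: q_def stein_slope_def g_def W_def left_diff_distrib)
  also have "\<dots> = (E1 (\<lambda>x. f x * g x) - E1 f * E1 g) / s + E1 (\<lambda>x. indicator {..z} (W x)) - gauss_cdf z"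
    unfolding avg_add avg_diff avg_divide avg_cmult E1_const ..
  finally have stein: "E1 (\<lambda>x. indicator {..z} (W x)) - gauss_cdf z
      = E1 q - (E1 (\<lambda>x. f x * g x) - E1 f * E1 g) / s" by simp
  have Tq: "E1 (\<lambda>x. stein_kernel f x * q x) = (\<Sum>i=1..n. E2 (\<lambda>x y. path_diff f i x y * single_diff f i x y * q x)) / 2"
  proof -
    have "(\<Sum>i=1..n. E2 (\<lambda>x y. path_diff f i x y * single_diff f i x y * q x))
        = E2 (\<lambda>x y. \<Sum>i=1..n. path_diff f i x y * single_diff f i x y * q x)"
      by (rule E2_sum[symmetric])
    also have "\<dots> / 2 = E1 (\<lambda>x. stein_kernel f x * q x)"
      unfolding E2_iterated stein_kernel_def avg_divide by (simp add: avg_mult_const[symmetric] avg_divide[symmetric] sum_distrib_right)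
    finally show ?thesis ..
  qed
  have "err = (\<Sum>i=1..n. E2 (\<lambda>x y. path_diff f i x y * single_diff g i x y)
        - (1 / s) * E2 (\<lambda>x y. path_diff f i x y * single_diff f i x y * q x)) / 2"
    unfolding err_def E2_cmult[symmetric]
    by (simp add: case_prod_beta' avg_diff[symmetric] right_diff_distrib mult.assoc)
  also have "\<dots> = (E1 (\<lambda>x. f x * g x) - E1 f * E1 g) - E1 (\<lambda>x. stein_kernel f x * q x) / s"
    unfolding covariance_formula Tq by (simp add: sum_subtractf diff_divide_distrib sum_divide_distrib mult.commute)
  finally have cov: "E1 (\<lambda>x. f x * g x) - E1 f * E1 g = E1 (\<lambda>x. stein_kernel f x * q x) / s + err" by simp
  have "\<bar>err\<bar> \<le> (\<Sum>i=1..n. (1 / s) * (2 * E2 (\<lambda>x y. \<bar>path_diff f i x y\<bar> * single_diff f i x y * k x))) / 2"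
  proof -
    have "\<bar>E2 (\<lambda>x y. path_diff f i x y * (single_diff g i x y - single_diff f i x y / s * q x))\<bar>
        \<le> (1 / s) * (2 * E2 (\<lambda>x y. \<bar>path_diff f i x y\<bar> * single_diff f i x y * k x))" if i: "i \<in> {1..n}" for i
    proof -
      have "\<bar>E2 (\<lambda>x y. path_diff f i x y * (single_diff g i x y - single_diff f i x y / s * q x))\<bar>
        \<le> E2 (\<lambda>x y. \<bar>path_diff f i x y * (single_diff g i x y - single_diff f i x y / s * q x)\<bar>)"
        by (rule order_trans[OF abs_avg_le]) (simp add: case_prod_beta')
      also have "\<dots> \<le> E2 (\<lambda>x y. (1 / s) * (\<bar>path_diff f i x y\<bar> * (single_diff f i x y * (k x - k (x(i := y i))))))"
      proof (rule E2_mono)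
        fix x y
        have "\<bar>single_diff g i x y - single_diff f i x y / s * q x\<bar> \<le> single_diff f i x y / s * (k x - k (x(i := y i)))"
          using stein_sol_taylor[of z "W x" "W (x(i := y i))"]
          unfolding W_diff by (simp add: single_diff_def[of g] g_def q_def k_def)
        from mult_left_mono[OF this abs_ge_zero[of "path_diff f i x y"]]
        show "\<bar>path_diff f i x y * (single_diff g i x y - single_diff f i x y / s * q x)\<bar>
          \<le> (1 / s) * (\<bar>path_diff f i x y\<bar> * (single_diff f i x y * (k x - k (x(i := y i)))))"
          by (simp add: abs_mult mult_ac)
      qed
      also have "\<dots> = (1 / s) * (2 * E2 (\<lambda>x y. \<bar>path_diff f i x y\<bar> * single_diff f i x y * k x))"
        unfolding E2_cmult symmetrised_increment[OF i] ..
      finally show ?thesis .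
    qed
    then have "(\<Sum>i=1..n. \<bar>E2 (\<lambda>x y. path_diff f i x y * (single_diff g i x y - single_diff f i x y / s * q x))\<bar>)
       \<le> (\<Sum>i=1..n. (1 / s) * (2 * E2 (\<lambda>x y. \<bar>path_diff f i x y\<bar> * single_diff f i x y * k x)))"
      by (rule sum_mono)
    then show ?thesis unfolding err_def using order_trans[OF sum_abs] by fastforce
  qed
  also have "\<dots> = (1 / s) * E1 (\<lambda>x. remainder_kernel f x * k x)"
    unfolding remainder_kernel_weighted by (simp add: sum_distrib_left sum_divide_distrib)
  also have "E1 (\<lambda>x. remainder_kernel f x * k x) = E1 (\<lambda>x. remainder_kernel f x * (k x + 1 - gauss_cdf z))"
    using mean_remainder_kernel[of f]
    by (simp add: algebra_simps avg_add avg_diff avg_mult_const avg_cmult)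
  also have "\<dots> \<le> E1 (\<lambda>x. \<bar>remainder_kernel f x\<bar>)"
  proof (rule avg_mono)
    fix x
    have "\<bar>remainder_kernel f x\<bar> * \<bar>k x + 1 - gauss_cdf z\<bar> \<le> \<bar>remainder_kernel f x\<bar> * 1"
      unfolding k_def by (rule mult_left_mono[OF abs_stein_gap_le_1]) simp
    then show "remainder_kernel f x * (k x + 1 - gauss_cdf z) \<le> \<bar>remainder_kernel f x\<bar>"
      by (metis abs_le_D1 abs_mult mult.right_neutral)
  qed
  finally have err: "\<bar>err\<bar> \<le> (1 / s) * E1 (\<lambda>x. \<bar>remainder_kernel f x\<bar>)" using s by (simp add: divide_right_mono)
  have "\<bar>E1 q - E1 (\<lambda>x. stein_kernel f x * q x) / s\<^sup>2\<bar> = \<bar>E1 (\<lambda>x. (s\<^sup>2 - stein_kernel f x) * q x)\<bar> / s\<^sup>2"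
  proof -
    have "E1 q - E1 (\<lambda>x. stein_kernel f x * q x) / s\<^sup>2 = E1 (\<lambda>x. (s\<^sup>2 - stein_kernel f x) * q x) / s\<^sup>2"
      using s(1) by (simp add: left_diff_distrib avg_diff avg_cmult diff_divide_distrib)
    then show ?thesis by simp
  qed
  also have "\<dots> \<le> E1 (\<lambda>x. \<bar>stein_kernel f x - s\<^sup>2\<bar>) / s\<^sup>2"
  proof (intro divide_right_mono order_trans[OF abs_avg_le] avg_mono)
    fix x
    have "\<bar>stein_kernel f x - s\<^sup>2\<bar> * \<bar>q x\<bar> \<le> \<bar>stein_kernel f x - s\<^sup>2\<bar> * 1"
      unfolding q_def by (rule mult_left_mono[OF abs_stein_slope_le_1]) simp
    then show "\<bar>(s\<^sup>2 - stein_kernel f x) * q x\<bar> \<le> \<bar>stein_kernel f x - s\<^sup>2\<bar>"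
      by (simp add: abs_mult abs_minus_commute)
  qed simp
  finally have main: "\<bar>E1 q - E1 (\<lambda>x. stein_kernel f x * q x) / s\<^sup>2\<bar> \<le> E1 (\<lambda>x. \<bar>stein_kernel f x - s\<^sup>2\<bar>) / s\<^sup>2" .
  have "E1 (\<lambda>x. indicator {..z} (W x)) - gauss_cdf z = (E1 q - E1 (\<lambda>x. stein_kernel f x * q x) / s\<^sup>2) - err / s"
    unfolding stein cov by (simp add: add_divide_distrib power2_eq_square)
  then have "\<bar>E1 (\<lambda>x. indicator {..z} (W x)) - gauss_cdf z\<bar>
      \<le> E1 (\<lambda>x. \<bar>stein_kernel f x - s\<^sup>2\<bar>) / s\<^sup>2 + \<bar>err\<bar> / s"
    using main s(1) by (simp add: abs_triangle_ineq4 order_trans[OF abs_triangle_ineq4])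
  also have "\<bar>err\<bar> / s \<le> E1 (\<lambda>x. \<bar>remainder_kernel f x\<bar>) / s\<^sup>2"
    using divide_right_mono[OF err less_imp_le[OF s(1)]] by (simp add: power2_eq_square)
  finally show ?thesis
    unfolding mean_stein_kernel mean_remainder_kernel Var1_def[symmetric] s(2)
    by (simp add: W_def s_def add_divide_distrib)
qed

text \<open>
  The two estimates for the change of \<open>D\<^sub>i * \<Delta>\<^sub>i\<close>: the crude one for the few indices adjacent to the
  changed coordinate, the fine one for all others.
\<close>

lemma product_increment_bound:
  fixes p q p' q' b \<beta> :: real
  assumes "\<bar>p\<bar> \<le> b" "\<bar>q\<bar> \<le> b" "\<bar>p'\<bar> \<le> b" "\<bar>q'\<bar> \<le> b"
  shows "\<bar>p * q - p' * q'\<bar> \<le> 2 * b\<^sup>2"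
    and "\<bar>p - p'\<bar> \<le> \<beta> \<Longrightarrow> \<bar>q - q'\<bar> \<le> \<beta> \<Longrightarrow> \<bar>p * q - p' * q'\<bar> \<le> 2 * b * \<beta>"
proof -
  have "\<bar>p\<bar> * \<bar>q\<bar> \<le> b * b" "\<bar>p'\<bar> * \<bar>q'\<bar> \<le> b * b" using assms by (auto intro!: mult_mono)
  then show "\<bar>p * q - p' * q'\<bar> \<le> 2 * b\<^sup>2"
    using abs_triangle_ineq4[of "p * q" "p' * q'"] by (simp add: abs_mult power2_eq_square)
  assume d: "\<bar>p - p'\<bar> \<le> \<beta>" "\<bar>q - q'\<bar> \<le> \<beta>"
  have "\<bar>p\<bar> * \<bar>q - q'\<bar> \<le> b * \<beta>" "\<bar>q'\<bar> * \<bar>p - p'\<bar> \<le> b * \<beta>" using assms d by (auto intro!: mult_mono)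
  moreover have "p * q - p' * q' = p * (q - q') + q' * (p - p')" by algebra
  ultimately show "\<bar>p * q - p' * q'\<bar> \<le> 2 * b * \<beta>"
    using abs_triangle_ineq[of "p * (q - q')" "q' * (p - p')"] by (simp add: abs_mult)
qed

text \<open>
  A step of the path taken after coordinate \<open>j\<close> was replaced does not see the original value of \<open>x j\<close>; a
  step taken before it changes by a second difference.
\<close>

lemma path_diff_increment:
  assumes xy: "x \<in> P" "y \<in> P" and ij: "i \<in> {1..n}" "j \<in> {1..n}" "i \<noteq> j" and a: "a \<in> Om" and "0 \<le> \<beta>"
    and second: "\<And>x a a'. x \<in> P \<Longrightarrow> a \<in> Om \<Longrightarrow> a' \<in> Om \<Longrightarrow>
      \<bar>f x - f (x(i := a)) - f (x(j := a')) + f (x(i := a, j := a'))\<bar> \<le> \<beta>"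
  shows "\<bar>path_diff f i x y - path_diff f i (x(j := a)) y\<bar> \<le> \<beta>"
    "\<bar>single_diff f i x y - single_diff f i (x(j := a)) y\<bar> \<le> \<beta>"
proof -
  have single: "\<bar>single_diff f i x y - single_diff f i (x(j := a)) y\<bar> \<le> \<beta>" if "x \<in> P" for x
    using second[OF that P_Om[OF xy(2) ij(1)] a] ij(3)
    by (simp add: single_diff_def fun_upd_twist)
  then show "\<bar>single_diff f i x y - single_diff f i (x(j := a)) y\<bar> \<le> \<beta>" using xy by simp
  show "\<bar>path_diff f i x y - path_diff f i (x(j := a)) y\<bar> \<le> \<beta>"
  proof (cases "j < i")
    case True
    then have "hybrid (i - 1) (x(j := a)) y = hybrid (i - 1) x y" by (auto simp: hybrid_def fun_eq_iff)
    then show ?thesis using ij \<open>0 \<le> \<beta>\<close> by (simp add: path_diff_eq)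
  next
    case False
    then have "hybrid (i - 1) (x(j := a)) y = (hybrid (i - 1) x y)(j := a)" using ij by (auto simp: hybrid_def)
    then show ?thesis using ij single[OF hybrid_P[OF xy], of "i - 1"] by (simp add: path_diff_eq)
  qed
qed

text \<open>
  Changing one coordinate alters the Stein kernel by at most \<open>B / 2\<close> and the remainder kernel by at most
  \<open>B = 2 * m * b\<^sup>2 + 2 * n * b * \<beta>\<close>: at most \<open>m\<close> adjacent indices contribute \<open>2 * b\<^sup>2\<close> each, and at most \<open>n\<close>
  others \<open>2 * b * \<beta>\<close> each.  The factor \<open>3 / 2\<close> adds up the two kernels.
\<close>

theorem kolmogorov_bound_by_differences:
  fixes b \<beta> :: real and m :: nat
  assumes pos: "Var1 f > 0"
    and first: "\<And>x i a. x \<in> P \<Longrightarrow> i \<in> {1..n} \<Longrightarrow> a \<in> Om \<Longrightarrow> \<bar>f x - f (x(i := a))\<bar> \<le> b"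
    and second: "\<And>x i j a a'. x \<in> P \<Longrightarrow> i \<in> {1..n} \<Longrightarrow> j \<in> {1..n} \<Longrightarrow> i \<notin> Adj j \<Longrightarrow> a \<in> Om \<Longrightarrow> a' \<in> Om \<Longrightarrow>
      \<bar>f x - f (x(i := a)) - f (x(j := a')) + f (x(i := a, j := a'))\<bar> \<le> \<beta>"
    and adj: "\<And>j. j \<in> Adj j" "\<And>j. finite (Adj j)" "\<And>j. card (Adj j) \<le> m"
    and "0 \<le> b" "0 \<le> \<beta>"
  shows "\<bar>E1 (\<lambda>x. indicator {..z} ((f x - E1 f) / sqrt (Var1 f))) - gauss_cdf z\<bar>
    \<le> 3 / 2 * sqrt (n / 2) * (2 * m * b\<^sup>2 + 2 * n * b * \<beta>) / Var1 f"
proof -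
  define B where "B = 2 * m * b\<^sup>2 + 2 * n * b * \<beta>"
  have single: "\<bar>single_diff f i x y\<bar> \<le> b" if "x \<in> P" "y \<in> P" "i \<in> {1..n}" for i x y
    using first[of x i "y i"] that P_Om by (auto simp: single_diff_def)
  have path: "\<bar>path_diff f i x y\<bar> \<le> b" if "x \<in> P" "y \<in> P" "i \<in> {1..n}" for i x y
    using single[OF hybrid_P[OF that(1,2)] that(2,3), of "i - 1"] that by (auto simp: path_diff_eq)
  \<comment> \<open>Used with \<open>u\<close> the identity for the Stein kernel and \<open>u\<close> the absolute value for the remainder kernel.\<close>
  have total: "(\<Sum>i=1..n. \<bar>u (path_diff f i x y) * single_diff f i x y
        - u (path_diff f i (x(j := a)) y) * single_diff f i (x(j := a)) y\<bar>) \<le> B"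
    if xy: "x \<in> P" "y \<in> P" and j: "j \<in> {1..n}" and a: "a \<in> Om"
      and u: "\<And>p. \<bar>u p\<bar> = \<bar>p\<bar>" "\<And>p q. \<bar>u p - u q\<bar> \<le> \<bar>p - q\<bar>" for x y j a and u :: "real \<Rightarrow> real"
  proof -
    let ?t = "\<lambda>i. \<bar>u (path_diff f i x y) * single_diff f i x y
        - u (path_diff f i (x(j := a)) y) * single_diff f i (x(j := a)) y\<bar>"
    have x': "x(j := a) \<in> P" using upd_P xy j a by blast
    have near: "?t i \<le> 2 * b\<^sup>2" if "i \<in> {1..n}" for i
      using single[OF xy that] single[OF x' xy(2) that] path[OF xy that] path[OF x' xy(2) that]
      by (intro product_increment_bound(1)) (auto simp: u)
    have far: "?t i \<le> 2 * b * \<beta>" if i: "i \<in> {1..n}" "i \<notin> Adj j" for i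
    proof -
      have "i \<noteq> j" using adj(1) i by auto
      note inc = path_diff_increment[OF xy i(1) j this a \<open>0 \<le> \<beta>\<close> second[OF _ i(1) j i(2)]]
      show ?thesis
        using single[OF xy i(1)] single[OF x' xy(2) i(1)] path[OF xy i(1)] path[OF x' xy(2) i(1)]
        by (intro product_increment_bound(2) inc order_trans[OF u(2) inc(1)]) (auto simp: u)
    qed
    have "(\<Sum>i=1..n. ?t i) = (\<Sum>i\<in>{1..n} \<inter> Adj j. ?t i) + (\<Sum>i\<in>{1..n} - Adj j. ?t i)"
      by (subst sum.union_disjoint[symmetric]) (auto intro!: sum.cong)
    also have "\<dots> \<le> card ({1..n} \<inter> Adj j) * (2 * b\<^sup>2) + card ({1..n} - Adj j) * (2 * b * \<beta>)"
      using near far by (intro add_mono sum_bounded_above) auto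
    also have "\<dots> \<le> m * (2 * b\<^sup>2) + n * (2 * b * \<beta>)"
    proof (intro add_mono mult_right_mono)
      have "card ({1..n} \<inter> Adj j) \<le> card (Adj j)" using adj(2) by (intro card_mono) auto
      then show "real (card ({1..n} \<inter> Adj j)) \<le> real m" using adj(3)[of j] by simp
      show "real (card ({1..n} - Adj j)) \<le> real n" using card_mono[of "{1..n}" "{1..n} - Adj j"] by simp
    qed (use \<open>0 \<le> b\<close> \<open>0 \<le> \<beta>\<close> in auto)
    finally show ?thesis by (simp add: B_def algebra_simps)
  qed
  have T: "\<bar>stein_kernel f x - stein_kernel f (x(j := a))\<bar> \<le> B / 2" if x: "x \<in> P" and j: "j \<in> {1..n}" and a: "a \<in> Om" for x j a
  proof -
    have "\<bar>stein_kernel f x - stein_kernel f (x(j := a))\<bar> \<le> E1 (\<lambda>y. B / 2)"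
      unfolding stein_kernel_def avg_diff[symmetric]
    proof (intro order_trans[OF abs_avg_le] avg_mono)
      fix y assume y: "y \<in> P"
      show "\<bar>(\<Sum>i = 1..n. path_diff f i x y * single_diff f i x y) / 2 -
         (\<Sum>i = 1..n. path_diff f i (x(j := a)) y * single_diff f i (x(j := a)) y) / 2\<bar> \<le> B / 2"
        unfolding diff_divide_distrib[symmetric] sum_subtractf[symmetric]
        using order_trans[OF sum_abs total[OF x y j a, of "\<lambda>p. p"]] by simp
    qed
    then show ?thesis by (simp add: E1_const)
  qed
  have S: "\<bar>remainder_kernel f x - remainder_kernel f (x(j := a))\<bar> \<le> B" if x: "x \<in> P" and j: "j \<in> {1..n}" and a: "a \<in> Om" for x j a
  proof -
    have "\<bar>remainder_kernel f x - remainder_kernel f (x(j := a))\<bar> \<le> E1 (\<lambda>y. B)"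
      unfolding remainder_kernel_def avg_diff[symmetric]
    proof (intro order_trans[OF abs_avg_le] avg_mono)
      fix y assume y: "y \<in> P"
      show "\<bar>(\<Sum>i = 1..n. \<bar>path_diff f i x y\<bar> * single_diff f i x y) -
         (\<Sum>i = 1..n. \<bar>path_diff f i (x(j := a)) y\<bar> * single_diff f i (x(j := a)) y)\<bar> \<le> B"
        unfolding sum_subtractf[symmetric]
        by (rule order_trans[OF sum_abs total[OF x y j a, of abs]]) auto
    qed
    then show ?thesis by (simp add: E1_const)
  qed
  have "(E1 (\<lambda>x. \<bar>stein_kernel f x - E1 (stein_kernel f)\<bar>) + E1 (\<lambda>x. \<bar>remainder_kernel f x - E1 (remainder_kernel f)\<bar>)) / Var1 f
    \<le> (sqrt (n / 2) * (B / 2) + sqrt (n / 2) * B) / Var1 f"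
    using pos by (intro divide_right_mono add_mono mean_abs_deviation_le T S) auto
  also have "\<dots> = 3 / 2 * sqrt (n / 2) * B / Var1 f" by (simp add: add_divide_distrib algebra_simps)
  finally show ?thesis using stein_kolmogorov_bound[OF pos, of z] unfolding B_def by linarith
qed

end

section \<open>Uniform permutations of a given cycle type\<close>

text \<open>
  \<open>(p, i, k)\<close> is the \<open>k\<close>-th position on the \<open>i\<close>-th cycle of length \<open>p\<close>.  All permutations of cycle type
  \<open>t\<close> are compared with the cyclic shift of the last component.
\<close>

definition cycle_model :: "nat \<Rightarrow> (nat \<Rightarrow> nat) \<Rightarrow> (nat \<times> nat \<times> nat) set" where
  "cycle_model n t = (SIGMA p:{1..n}. {..<t p} \<times> {..<p})"

definition parametrises_cycles :: "nat \<Rightarrow> (nat \<Rightarrow> nat) \<Rightarrow> (nat \<times> nat \<times> nat \<Rightarrow> nat) \<Rightarrow> (nat \<Rightarrow> nat) \<Rightarrow> bool" where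
  "parametrises_cycles n t b \<tau> \<longleftrightarrow> bij_betw b (cycle_model n t) {1..n} \<and>
     (\<forall>p i k. (p, i, k) \<in> cycle_model n t \<longrightarrow> \<tau> (b (p, i, k)) = b (p, i, Suc k mod p))"

text \<open>
  For every \<open>p\<close>, number the cycles of length \<open>p\<close> and choose a base point on each; the point \<open>(p, i, k)\<close>
  is sent to the \<open>k\<close>-th iterate of the base point.
\<close>

lemma cycle_parametrisation_exists:
  assumes "\<tau> \<in> cyclic_perms n t"
  shows "\<exists>b. parametrises_cycles n t b \<tau>"
proof -
  have per: "\<tau> permutes {1..n}" and cnt: "\<And>p. p \<in> {1..n} \<Longrightarrow> card {C \<in> cycles_of n \<tau>. card C = p} = t p"
    using assms by (auto simp: cyclic_perms_def)
  have perm: "permutation \<tau>" using per by (auto simp: permutation_permutes)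
  have cyc: "cyclic_on \<tau> (orbit \<tau> y)" for y using perm by (rule cyclic_on_orbit')
  have self: "y \<in> orbit \<tau> y" for y using perm by (rule permutation_self_in_orbit)
  have fin: "finite (cycles_of n \<tau>)" by (simp add: cycles_of_def)
  have "\<exists>h. bij_betw h {..<t p} {C \<in> cycles_of n \<tau>. card C = p}" if "p \<in> {1..n}" for p
    using ex_bij_betw_nat_finite[of "{C \<in> cycles_of n \<tau>. card C = p}"] fin cnt[OF that]
    by (auto simp: atLeast0LessThan)
  then obtain e where e: "\<And>p. p \<in> {1..n} \<Longrightarrow> bij_betw (e p) {..<t p} {C \<in> cycles_of n \<tau>. card C = p}"
    by metis
  define base where "base p i = (SOME y. orbit \<tau> y = e p i)" for p i
  have base: "orbit \<tau> (base p i) = e p i" "card (e p i) = p" if "p \<in> {1..n}" "i < t p" for p i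
  proof -
    have m: "e p i \<in> {C \<in> cycles_of n \<tau>. card C = p}"
      by (rule bij_betw_apply[OF e[OF that(1)]]) (use that(2) in simp)
    then have "e p i \<in> orbit \<tau> ` {1..n}" unfolding cycles_of_def by blast
    then obtain y where "e p i = orbit \<tau> y" by blast
    then have "\<exists>y. orbit \<tau> y = e p i" by metis
    then show "orbit \<tau> (base p i) = e p i" unfolding base_def by (rule someI_ex)
    show "card (e p i) = p" using m by blast
  qed
  have e_sub: "e p i \<subseteq> {1..n}" if "p \<in> {1..n}" "i < t p" for p i
  proof -
    have "e p i \<in> {C \<in> cycles_of n \<tau>. card C = p}"
      by (rule bij_betw_apply[OF e[OF that(1)]]) (use that(2) in simp)
    then obtain y where "y \<in> {1..n}" "e p i = orbit \<tau> y" unfolding cycles_of_def by blast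
    then show ?thesis using permutes_orbit_subset[OF per] by simp
  qed
  have orb: "e p i = (\<lambda>k. (\<tau> ^^ k) (base p i)) ` {..<p}" "inj_on (\<lambda>k. (\<tau> ^^ k) (base p i)) {..<p}"
    "(\<tau> ^^ p) (base p i) = base p i" if "p \<in> {1..n}" "i < t p" for p i
  proof -
    let ?y = "base p i" and ?d = "funpow_dist1 \<tau> (base p i) (base p i)"
    have img: "orbit \<tau> ?y = (\<lambda>k. (\<tau> ^^ k) ?y) ` {0..<?d}" by (rule orbit_conv_funpow_dist1[OF self])
    have inj: "inj_on (\<lambda>k. (\<tau> ^^ k) ?y) {0..<?d}" by (rule inj_on_funpow_dist1[OF self])
    have "p = ?d" using base[OF that] card_image[OF inj] unfolding img[symmetric] by simp
    then show "e p i = (\<lambda>k. (\<tau> ^^ k) ?y) ` {..<p}" "inj_on (\<lambda>k. (\<tau> ^^ k) ?y) {..<p}"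
      "(\<tau> ^^ p) ?y = ?y"
      using img inj base[OF that] funpow_dist1_prop[OF self[of ?y]] by (auto simp: atLeast0LessThan)
  qed
  define b where "b = (\<lambda>(p, i, k). (\<tau> ^^ k) (base p i))"
  have b_in: "b (p, i, k) \<in> e p i" if "p \<in> {1..n}" "i < t p" "k < p" for p i k
    using orb(1)[OF that(1,2)] that(3) by (auto simp: b_def)
  have step: "\<tau> (b (p, i, k)) = b (p, i, Suc k mod p)" if "p \<in> {1..n}" "i < t p" "k < p" for p i k
    using orb(3)[OF that(1,2)] that(3) by (cases "Suc k = p") (auto simp: b_def)
  have "bij_betw b (cycle_model n t) {1..n}"
    unfolding bij_betw_def
  proof
    show "inj_on b (cycle_model n t)"
    proof (rule inj_onI)
      fix d d' assume dd: "d \<in> cycle_model n t" "d' \<in> cycle_model n t" "b d = b d'"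
      obtain p i k p' i' k' where d: "d = (p, i, k)" "d' = (p', i', k')" by (cases d, cases d') auto
      have m: "(p, i, k) \<in> cycle_model n t" "(p', i', k') \<in> cycle_model n t" and eq: "b (p, i, k) = b (p', i', k')"
        using dd d by auto
      have m1: "p \<in> {1..n}" "i < t p" "k < p" "p' \<in> {1..n}" "i' < t p'" "k' < p'"
        using m by (auto simp: cycle_model_def)
      have "e p i = orbit \<tau> (b (p, i, k))" "e p' i' = orbit \<tau> (b (p', i', k'))"
        using orbit_cyclic_eq3[OF cyc] b_in[OF m1(1-3)] b_in[OF m1(4-6)] base(1)[OF m1(1,2)] base(1)[OF m1(4,5)] by metis+
      then have E: "e p i = e p' i'" using eq by simp
      then have "p = p'" using base(2)[OF m1(1,2)] base(2)[OF m1(4,5)] by simp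
      moreover from this have "i = i'" using E e[OF m1(1)] m1 by (auto simp: bij_betw_def inj_on_def)
      moreover from calculation have "k = k'" using eq orb(2)[OF m1(1,2)] m1 by (auto simp: b_def inj_on_def)
      ultimately show "d = d'" by (simp add: d)
    qed
    show "b ` cycle_model n t = {1..n}"
    proof
      show "b ` cycle_model n t \<subseteq> {1..n}"
      proof (rule image_subsetI)
        fix d assume "d \<in> cycle_model n t"
        then obtain p i k where "d = (p, i, k)" and pik: "p \<in> {1..n}" "i < t p" "k < p"
          by (auto simp: cycle_model_def)
        then show "b d \<in> {1..n}" using b_in[OF pik] e_sub[OF pik(1,2)] by blast
      qed
      show "{1..n} \<subseteq> b ` cycle_model n t"
      proof
        fix y assume y: "y \<in> {1..n}"
        let ?C = "orbit \<tau> y"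
        have sub: "?C \<subseteq> {1..n}" using per y by (rule permutes_orbit_subset)
        have C: "?C \<in> cycles_of n \<tau>" using y by (auto simp: cycles_of_def)
        have "card ?C \<le> n" using card_mono[OF _ sub] by simp
        moreover have "card ?C \<ge> 1" using self[of y] finite_subset[OF sub] by (auto simp: Suc_le_eq card_gt_0_iff)
        ultimately have p: "card ?C \<in> {1..n}" by simp
        have "?C \<in> e (card ?C) ` {..<t (card ?C)}"
          unfolding bij_betw_imp_surj_on[OF e[OF p]] using C by blast
        then obtain i where i: "i < t (card ?C)" "e (card ?C) i = ?C" by blast
        obtain k where "k < card ?C" "y = b (card ?C, i, k)"
          using orb(1)[OF p i(1)] self[of y] i(2) by (auto simp: b_def)
        then show "y \<in> b ` cycle_model n t" using p i by (auto simp: cycle_model_def)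
      qed
    qed
  qed
  then show ?thesis
    using step unfolding parametrises_cycles_def by (intro exI[of _ b]) (auto simp: cycle_model_def)
qed

lemma card_cycle_model: "card (cycle_model n t) = (\<Sum>p=1..n. p * t p)"
  unfolding cycle_model_def by (subst card_SigmaI) (auto simp: card_cartesian_product mult.commute)

text \<open>
  Conversely, the cycle model has \<open>n\<close> elements, so the shift can be transported to \<open>{1..n}\<close> along any
  bijection.
\<close>

lemma cyclic_perms_nonempty:
  assumes "cycle_type n t"
  shows "cyclic_perms n t \<noteq> {}"
proof -
  let ?D = "cycle_model n t"
  have finD: "finite ?D" by (auto simp: cycle_model_def)
  have "card ?D = card {1..n}" using assms by (simp add: card_cycle_model cycle_type_def)
  then obtain b where b: "bij_betw b ?D {1..n}" using finite_same_card_bij[OF finD] by blast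
  define c :: "nat \<times> nat \<times> nat \<Rightarrow> nat \<times> nat \<times> nat" where "c = (\<lambda>(p, i, k). (p, i, Suc k mod p))"
  have c: "bij_betw c ?D ?D"
  \<comment> \<open>The inverse shift uses \<open>k + p - 1\<close> because \<open>k - 1\<close> truncates at 0.\<close>
  proof (rule bij_betw_byWitness[where f' = "\<lambda>(p, i, k). (p, i, (k + p - 1) mod p)"])
    have "(Suc k mod p + p - 1) mod p = k" "Suc ((k + p - 1) mod p) mod p = k" if "k < p" for k p :: nat
    proof -
      show "(Suc k mod p + p - 1) mod p = k" using that by (cases "Suc k = p") auto
      have "Suc (k + p - 1) = k + p" using that by simp
      then show "Suc ((k + p - 1) mod p) mod p = k" using that by (simp only: mod_Suc_eq) simp
    qed
    then show "\<forall>d\<in>?D. (\<lambda>(p, i, k). (p, i, (k + p - 1) mod p)) (c d) = d"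
      "\<forall>d\<in>?D. c ((\<lambda>(p, i, k). (p, i, (k + p - 1) mod p)) d) = d"
      by (auto simp: c_def cycle_model_def)
  qed (auto simp: c_def cycle_model_def)
  define \<tau> where "\<tau> y = (if y \<in> {1..n} then b (c (inv_into ?D b y)) else y)" for y
  have \<tau>_b: "\<tau> (b d) = b (c d)" if "d \<in> ?D" for d
    using that b bij_betwE[OF b] by (auto simp: \<tau>_def bij_betw_inv_into_left)
  have "bij_betw (b \<circ> c \<circ> inv_into ?D b) {1..n} {1..n}"
    using bij_betw_trans[OF bij_betw_inv_into[OF b] bij_betw_trans[OF c b]] by (simp add: comp_assoc)
  moreover have "bij_betw \<tau> {1..n} {1..n} = bij_betw (b \<circ> c \<circ> inv_into ?D b) {1..n} {1..n}"
    by (rule Fun.bij_betw_cong) (simp add: \<tau>_def)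
  ultimately have "bij_betw \<tau> {1..n} {1..n}" by simp
  then have per: "\<tau> permutes {1..n}" by (rule bij_imp_permutes) (auto simp: \<tau>_def)
  define block where "block p i = (\<lambda>k. b (p, i, k)) ` {..<p}" for p i
  have pow: "(\<tau> ^^ m) (b (p, i, k)) = b (p, i, (k + m) mod p)" if "p \<in> {1..n}" "i < t p" "k < p" for m p i k
  proof (induction m)
    case (Suc m)
    have "(p, i, (k + m) mod p) \<in> ?D" using that by (auto simp: cycle_model_def)
    from \<tau>_b[OF this] Suc show ?case by (simp add: c_def mod_Suc_eq)
  qed (use that in simp)
  have orb: "orbit \<tau> (b (p, i, k)) = block p i" if "p \<in> {1..n}" "i < t p" "k < p" for p i k
  proof
    show "orbit \<tau> (b (p, i, k)) \<subseteq> block p i"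
    proof
      fix y assume "y \<in> orbit \<tau> (b (p, i, k))"
      then obtain m where "y = (\<tau> ^^ m) (b (p, i, k))" unfolding orbit_altdef by blast
      then have "y = b (p, i, (k + m) mod p)" using pow[OF that] by simp
      moreover have "(k + m) mod p < p" using that by simp
      ultimately show "y \<in> block p i" unfolding block_def by blast
    qed
    show "block p i \<subseteq> orbit \<tau> (b (p, i, k))"
    proof
      fix y assume "y \<in> block p i"
      then obtain k' where k': "k' < p" "y = b (p, i, k')" by (auto simp: block_def)
      then have "(\<tau> ^^ (k' + p - k)) (b (p, i, k)) = y" using that by (subst pow[OF that]) simp
      moreover have "0 < k' + p - k" using that by simp
      ultimately show "y \<in> orbit \<tau> (b (p, i, k))" unfolding orbit_altdef by blast
    qed
  qed
  have injb: "inj_on b ?D" using b by (auto simp: bij_betw_def)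
  have card_block: "card (block p i) = p" if "p \<in> {1..n}" "i < t p" for p i
  proof -
    have "inj_on (\<lambda>k. b (p, i, k)) {..<p}"
    proof (rule inj_onI)
      fix k k' assume "k \<in> {..<p}" "k' \<in> {..<p}" "b (p, i, k) = b (p, i, k')"
      then show "k = k'" using inj_onD[OF injb, of "(p, i, k)" "(p, i, k')"] that by (simp add: cycle_model_def)
    qed
    then show ?thesis unfolding block_def by (simp add: card_image)
  qed
  have "cycles_of n \<tau> = (\<lambda>d. orbit \<tau> (b d)) ` ?D"
    unfolding cycles_of_def bij_betw_imp_surj_on[OF b, symmetric] image_image ..
  also have "\<dots> = {block p i | p i. p \<in> {1..n} \<and> i < t p}"
  proof (intro set_eqI iffI)
    fix C assume "C \<in> (\<lambda>d. orbit \<tau> (b d)) ` ?D"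
    then obtain p i k where "C = orbit \<tau> (b (p, i, k))" and pik: "p \<in> {1..n}" "i < t p" "k < p"
      by (auto simp: cycle_model_def)
    then show "C \<in> {block p i | p i. p \<in> {1..n} \<and> i < t p}" using orb[OF pik] by blast
  next
    fix C assume "C \<in> {block p i | p i. p \<in> {1..n} \<and> i < t p}"
    then obtain p i where C: "C = block p i" and pi: "p \<in> {1..n}" "i < t p" by blast
    have "0 < p" using pi by simp
    have "(p, i, 0) \<in> ?D" using pi by (auto simp: cycle_model_def)
    then show "C \<in> (\<lambda>d. orbit \<tau> (b d)) ` ?D" unfolding C orb[OF pi \<open>0 < p\<close>, symmetric] by blast
  qed
  finally have cyc: "cycles_of n \<tau> = {block p i | p i. p \<in> {1..n} \<and> i < t p}" .
  have "card {C \<in> cycles_of n \<tau>. card C = p} = t p" if p: "p \<in> {1..n}" for p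
  proof -
    have "{C \<in> cycles_of n \<tau>. card C = p} = block p ` {..<t p}"
      using p card_block by (auto simp: cyc)
    moreover have "inj_on (block p) {..<t p}"
    proof (rule inj_onI)
      fix i i' assume i: "i \<in> {..<t p}" "i' \<in> {..<t p}" and "block p i = block p i'"
      then have "b (p, i, 0) \<in> block p i'" using p unfolding block_def by force
      then obtain k where "k < p" "b (p, i, 0) = b (p, i', k)" by (auto simp: block_def)
      then show "i = i'" using inj_onD[OF injb, of "(p, i, 0)" "(p, i', k)"] i p by (auto simp: cycle_model_def)
    qed
    ultimately show ?thesis by (simp add: card_image)
  qed
  then show ?thesis using per by (auto simp: cyclic_perms_def)
qed

text \<open>
  Compose one cycle parametrisation with the inverse of the other.
\<close>

lemma cyclic_perms_conjugate:
  assumes "\<sigma> \<in> cyclic_perms n t" "\<tau> \<in> cyclic_perms n t"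
  shows "\<exists>\<rho>. \<rho> permutes {1..n} \<and> \<tau> = \<rho> \<circ> \<sigma> \<circ> inv \<rho>"
proof -
  let ?D = "cycle_model n t"
  obtain a b where ab: "parametrises_cycles n t a \<sigma>" "parametrises_cycles n t b \<tau>"
    using assms cycle_parametrisation_exists by metis
  have bij: "bij_betw a ?D {1..n}" "bij_betw b ?D {1..n}" using ab by (auto simp: parametrises_cycles_def)
  define \<rho> where "\<rho> y = (if y \<in> {1..n} then b (inv_into ?D a y) else y)" for y
  have \<rho>_a: "\<rho> (a d) = b d" if "d \<in> ?D" for d
    using that bij bij_betwE[OF bij(1)] by (auto simp: \<rho>_def bij_betw_inv_into_left)
  have "bij_betw (b \<circ> inv_into ?D a) {1..n} {1..n}"
    using bij_betw_inv_into[OF bij(1)] bij(2) by (rule bij_betw_trans)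
  moreover have "bij_betw \<rho> {1..n} {1..n} = bij_betw (b \<circ> inv_into ?D a) {1..n} {1..n}"
    by (rule Fun.bij_betw_cong) (simp add: \<rho>_def)
  ultimately have "bij_betw \<rho> {1..n} {1..n}" by simp
  then have per: "\<rho> permutes {1..n}" by (rule bij_imp_permutes) (auto simp: \<rho>_def)
  have "\<tau> (\<rho> y) = \<rho> (\<sigma> y)" for y
  proof (cases "y \<in> {1..n}")
    case True
    then obtain p i k where d: "(p, i, k) \<in> ?D" "y = a (p, i, k)"
      using bij_betw_imp_surj_on[OF bij(1)] by (metis imageE prod_cases3)
    have d': "(p, i, Suc k mod p) \<in> ?D" using d by (auto simp: cycle_model_def)
    have "\<sigma> (a (p, i, k)) = a (p, i, Suc k mod p)" "\<tau> (b (p, i, k)) = b (p, i, Suc k mod p)"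
      using ab d(1) unfolding parametrises_cycles_def by blast+
    then show ?thesis by (simp add: d(2) \<rho>_a[OF d(1)] \<rho>_a[OF d'])
  next
    case False
    have "\<sigma> permutes {1..n}" "\<tau> permutes {1..n}" using assms by (simp_all add: cyclic_perms_def)
    then have "\<sigma> y = y" "\<tau> y = y" using False permutes_not_in by metis+
    moreover have "\<rho> y = y" using False by (auto simp: \<rho>_def)
    ultimately show ?thesis by simp
  qed
  from this[of "inv \<rho> y" for y] have "\<tau> = \<rho> \<circ> \<sigma> \<circ> inv \<rho>"
    by (simp add: fun_eq_iff permutes_inverses[OF per])
  with per show ?thesis by blast
qed

lemma cyclic_perms_closed_conj:
  assumes \<tau>: "\<tau> \<in> cyclic_perms n t" and \<rho>: "\<rho> permutes {1..n}"
  shows "\<rho> \<circ> \<tau> \<circ> inv \<rho> \<in> cyclic_perms n t"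
proof -
  have per: "\<tau> permutes {1..n}" using \<tau> by (simp add: cyclic_perms_def)
  have per': "\<rho> \<circ> \<tau> \<circ> inv \<rho> permutes {1..n}"
    using per \<rho> by (intro permutes_compose permutes_inv)
  have inj: "inj \<rho>" using \<rho> by (rule permutes_inj)
  have "permutation \<tau>" using per by (auto simp: permutation_permutes)
  have orb: "orbit (\<rho> \<circ> \<tau> \<circ> inv \<rho>) (\<rho> x) = \<rho> ` orbit \<tau> x" for x
    by (rule orbit_inverse[symmetric])
      (use permutation_self_in_orbit[OF \<open>permutation \<tau>\<close>] permutes_inverses[OF \<rho>] in auto)
  have "cycles_of n (\<rho> \<circ> \<tau> \<circ> inv \<rho>) = orbit (\<rho> \<circ> \<tau> \<circ> inv \<rho>) ` \<rho> ` {1..n}"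
    using permutes_image[OF \<rho>] by (simp add: cycles_of_def)
  also have "\<dots> = (`) \<rho> ` cycles_of n \<tau>" by (simp only: cycles_of_def image_image orb)
  finally have "{C \<in> cycles_of n (\<rho> \<circ> \<tau> \<circ> inv \<rho>). card C = p} = (`) \<rho> ` {C \<in> cycles_of n \<tau>. card C = p}" for p
    using card_image[OF inj_on_subset[OF inj subset_UNIV]] by auto
  moreover have "inj_on ((`) \<rho>) A" for A using inj by (auto simp: inj_on_def inj_image_eq_iff)
  ultimately show ?thesis using \<tau> per' by (auto simp: cyclic_perms_def card_image)
qed

lemma finite_cyclic_perms: "finite (cyclic_perms n t)"
  by (rule finite_subset[OF _ finite_permutations[of "{1..n}"]]) (auto simp: cyclic_perms_def)

text \<open>
  The conjugacy class is invariant under every conjugation, so one may first conjugate by a further uniform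
  \<open>\<rho>\<close>.  As all elements of the class are conjugate, the average over \<open>\<rho>\<close> no longer depends on the element
  that is conjugated.
\<close>

lemma avg_cyclic_perms:
  assumes \<sigma>: "\<sigma> \<in> cyclic_perms n t"
  shows "avg (cyclic_perms n t) F = avg {\<rho>. \<rho> permutes {1..n}} (\<lambda>\<rho>. F (\<rho> \<circ> \<sigma> \<circ> inv \<rho>))"
proof -
  let ?S = "{\<rho>. \<rho> permutes {1..n}}" and ?C = "cyclic_perms n t"
  have S: "finite ?S" "?S \<noteq> {}" using finite_permutations[of "{1..n}"] permutes_id[of "{1..n}"] by (simp, blast)
  have C: "finite ?C" "?C \<noteq> {}" using finite_cyclic_perms \<sigma> by auto
  have conj: "avg ?C F = avg ?C (\<lambda>\<tau>. F (\<rho> \<circ> \<tau> \<circ> inv \<rho>))" if \<rho>: "\<rho> \<in> ?S" for \<rho>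
  proof (rule avg_bij, rule bij_betw_byWitness[where f' = "\<lambda>\<tau>. inv \<rho> \<circ> \<tau> \<circ> \<rho>"])
    have inv: "inv \<rho> permutes {1..n}" "inv (inv \<rho>) = \<rho>" using \<rho> by (auto intro: permutes_inv permutes_inv_inv)
    have "inv \<rho> \<circ> \<tau> \<circ> \<rho> \<in> ?C" if "\<tau> \<in> ?C" for \<tau>
      using cyclic_perms_closed_conj[OF that inv(1)] inv(2) by simp
    then show "(\<lambda>\<tau>. inv \<rho> \<circ> \<tau> \<circ> \<rho>) ` ?C \<subseteq> ?C" by auto
    show "(\<lambda>\<tau>. \<rho> \<circ> \<tau> \<circ> inv \<rho>) ` ?C \<subseteq> ?C" using cyclic_perms_closed_conj \<rho> by auto
  qed (use \<rho> in \<open>auto simp: fun_eq_iff permutes_inverses\<close>)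
  have same: "avg ?S (\<lambda>\<rho>. F (\<rho> \<circ> \<tau> \<circ> inv \<rho>)) = avg ?S (\<lambda>\<rho>. F (\<rho> \<circ> \<sigma> \<circ> inv \<rho>))" if \<tau>: "\<tau> \<in> ?C" for \<tau>
  proof -
    obtain \<kappa> where \<kappa>: "\<kappa> permutes {1..n}" "\<tau> = \<kappa> \<circ> \<sigma> \<circ> inv \<kappa>" using cyclic_perms_conjugate[OF \<sigma> \<tau>] by blast
    have bij: "bij_betw (\<lambda>\<rho>. \<rho> \<circ> \<kappa>) ?S ?S"
      by (rule bij_betw_byWitness[where f' = "\<lambda>\<rho>. \<rho> \<circ> inv \<kappa>"])
        (use \<kappa>(1) in \<open>auto intro: permutes_compose permutes_inv simp: comp_assoc permutes_inv_o\<close>)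
    have "avg ?S (\<lambda>\<rho>. F (\<rho> \<circ> \<sigma> \<circ> inv \<rho>)) = avg ?S (\<lambda>\<rho>. F ((\<rho> \<circ> \<kappa>) \<circ> \<sigma> \<circ> inv (\<rho> \<circ> \<kappa>)))"
      by (rule avg_bij[OF bij])
    also have "\<dots> = avg ?S (\<lambda>\<rho>. F (\<rho> \<circ> \<tau> \<circ> inv \<rho>))"
      by (rule avg_cong) (use \<kappa> in \<open>auto simp: o_inv_distrib permutes_bij comp_assoc\<close>)
    finally show ?thesis ..
  qed
  have "avg ?C F = avg ?S (\<lambda>\<rho>. avg ?C F)" using S by (simp add: avg_const)
  also have "\<dots> = avg ?S (\<lambda>\<rho>. avg ?C (\<lambda>\<tau>. F (\<rho> \<circ> \<tau> \<circ> inv \<rho>)))" by (rule avg_cong) (rule conj)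
  also have "\<dots> = avg ?C (\<lambda>\<tau>. avg ?S (\<lambda>\<rho>. F (\<rho> \<circ> \<tau> \<circ> inv \<rho>)))" by (rule avg_swap)
  also have "\<dots> = avg ?C (\<lambda>_. avg ?S (\<lambda>\<rho>. F (\<rho> \<circ> \<sigma> \<circ> inv \<rho>)))" by (rule avg_cong) (rule same)
  also have "\<dots> = avg ?S (\<lambda>\<rho>. F (\<rho> \<circ> \<sigma> \<circ> inv \<rho>))" using C by (rule avg_const)
  finally show ?thesis .
qed

section \<open>Pattern counts as functions of labels\<close>

text \<open>
  The pattern occurs among the points \<open>(u k, u (\<sigma> k))\<close> with \<open>k \<in> A\<close>; the function \<open>a\<close> lists these points
  from left to right.
\<close>

definition occurs_at :: "nat \<Rightarrow> (nat \<Rightarrow> nat) \<Rightarrow> (nat \<Rightarrow> nat) \<Rightarrow> (nat \<Rightarrow> nat) \<Rightarrow> nat set \<Rightarrow> bool" where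
  "occurs_at r \<pi> \<sigma> u A \<longleftrightarrow> (\<exists>a. A = a ` {1..r} \<and> strict_mono_on {1..r} (u \<circ> a) \<and>
      (\<forall>j\<in>{1..r}. \<forall>k\<in>{1..r}. \<pi> j > \<pi> k \<longleftrightarrow> u (\<sigma> (a j)) > u (\<sigma> (a k))))"

definition label_count :: "nat \<Rightarrow> (nat \<Rightarrow> nat) \<Rightarrow> nat \<Rightarrow> (nat \<Rightarrow> nat) \<Rightarrow> (nat \<Rightarrow> nat) \<Rightarrow> nat" where
  "label_count r \<pi> n \<sigma> u = card {A. A \<subseteq> {1..n} \<and> occurs_at r \<pi> \<sigma> u A}"

lemma occurs_at_card:
  assumes "occurs_at r \<pi> \<sigma> u A"
  shows "card A = r"
proof -
  obtain a where a: "A = a ` {1..r}" "strict_mono_on {1..r} (u \<circ> a)" using assms by (auto simp: occurs_at_def)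
  have "inj_on a {1..r}" using strict_mono_on_imp_inj_on[OF a(2)] by (rule inj_on_imageI2)
  then show ?thesis using a(1) by (simp add: card_image)
qed

text \<open>
  Only the relative order of the labels matters, and only of those carried by \<open>A\<close> and its image.
\<close>

lemma occurs_at_cong:
  assumes "\<And>i j. i \<in> A \<union> \<sigma> ` A \<Longrightarrow> j \<in> A \<union> \<sigma> ` A \<Longrightarrow> u i < u j \<longleftrightarrow> w i < w j"
  shows "occurs_at r \<pi> \<sigma> u A = occurs_at r \<pi> \<sigma> w A"
proof -
  have "occurs_at r \<pi> \<sigma> w A" if occ: "occurs_at r \<pi> \<sigma> u A"
    and iff: "\<And>i j. i \<in> A \<union> \<sigma> ` A \<Longrightarrow> j \<in> A \<union> \<sigma> ` A \<Longrightarrow> u i < u j \<longleftrightarrow> w i < w j" for u w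
  proof -
    obtain a where a: "A = a ` {1..r}" "strict_mono_on {1..r} (u \<circ> a)"
      "\<And>j k. j \<in> {1..r} \<Longrightarrow> k \<in> {1..r} \<Longrightarrow> \<pi> j > \<pi> k \<longleftrightarrow> u (\<sigma> (a j)) > u (\<sigma> (a k))"
      using occ unfolding occurs_at_def by blast
    have aA: "a j \<in> A" if "j \<in> {1..r}" for j using that a(1) by blast
    have "strict_mono_on {1..r} (w \<circ> a)"
    proof (rule strict_mono_onI)
      fix j k assume jk: "j \<in> {1..r}" "k \<in> {1..r}" "j < k"
      then have "u (a j) < u (a k)" using strict_mono_onD[OF a(2)] by (metis comp_apply)
      then show "(w \<circ> a) j < (w \<circ> a) k" using iff[of "a j" "a k"] aA[OF jk(1)] aA[OF jk(2)] by simp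
    qed
    moreover have "\<pi> j > \<pi> k \<longleftrightarrow> w (\<sigma> (a j)) > w (\<sigma> (a k))" if "j \<in> {1..r}" "k \<in> {1..r}" for j k
      using a(3)[OF that] iff[of "\<sigma> (a k)" "\<sigma> (a j)"] aA that by blast
    ultimately show ?thesis unfolding occurs_at_def using a(1) by blast
  qed
  then show ?thesis using assms by blast
qed

lemma label_count_cong:
  assumes \<sigma>: "\<sigma> permutes {1..n}"
    and iff: "\<And>i j. i \<in> {1..n} \<Longrightarrow> j \<in> {1..n} \<Longrightarrow> u i < u j \<longleftrightarrow> w i < w j"
  shows "label_count r \<pi> n \<sigma> u = label_count r \<pi> n \<sigma> w"
proof -
  have "occurs_at r \<pi> \<sigma> u A = occurs_at r \<pi> \<sigma> w A" if "A \<subseteq> {1..n}" for A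
  proof (rule occurs_at_cong)
    have "A \<union> \<sigma> ` A \<subseteq> {1..n}" using that permutes_image[OF \<sigma>] by blast
    then show "u i < u j \<longleftrightarrow> w i < w j" if "i \<in> A \<union> \<sigma> ` A" "j \<in> A \<union> \<sigma> ` A" for i j
      using that iff by blast
  qed
  then show ?thesis unfolding label_count_def by (metis (mono_tags, lifting))
qed

text \<open>
  The labels \<open>\<rho>\<close> put the points \<open>(\<rho> k, \<rho> (\<sigma> k))\<close> on the graph of \<open>\<rho> \<sigma> \<rho>\<inverse>\<close>, so \<open>A\<close> corresponds to the set
  of positions \<open>\<rho> ` A\<close>.
\<close>

lemma pattern_count_conjugate:
  assumes \<rho>: "\<rho> permutes {1..n}"
  shows "pattern_count r \<pi> n (\<rho> \<circ> \<sigma> \<circ> inv \<rho>) = label_count r \<pi> n \<sigma> \<rho>"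
proof -
  let ?occ = "\<lambda>i. strict_mono_on {1..r} i \<and>
     (\<forall>j\<in>{1..r}. \<forall>k\<in>{1..r}. \<pi> j > \<pi> k \<longleftrightarrow> (\<rho> \<circ> \<sigma> \<circ> inv \<rho>) (i j) > (\<rho> \<circ> \<sigma> \<circ> inv \<rho>) (i k))"
  have inv: "inv \<rho> (\<rho> x) = x" "\<rho> (inv \<rho> x) = x" for x using permutes_inverses[OF \<rho>] by auto
  have eq: "(\<exists>i. ?occ i \<and> \<rho> ` A = i ` {1..r}) = occurs_at r \<pi> \<sigma> \<rho> A" for A
  proof
    assume "\<exists>i. ?occ i \<and> \<rho> ` A = i ` {1..r}"
    then obtain i where i: "?occ i" "\<rho> ` A = i ` {1..r}" by blast
    have "A = inv \<rho> ` \<rho> ` A" by (simp add: image_image inv)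
    also have "\<dots> = (inv \<rho> \<circ> i) ` {1..r}" by (simp add: i(2) image_comp)
    finally show "occurs_at r \<pi> \<sigma> \<rho> A"
      unfolding occurs_at_def using i(1) by (intro exI[of _ "inv \<rho> \<circ> i"]) (simp add: comp_def inv)
  next
    assume "occurs_at r \<pi> \<sigma> \<rho> A"
    then obtain a where "A = a ` {1..r}" "strict_mono_on {1..r} (\<rho> \<circ> a)"
      "\<forall>j\<in>{1..r}. \<forall>k\<in>{1..r}. \<pi> j > \<pi> k \<longleftrightarrow> \<rho> (\<sigma> (a j)) > \<rho> (\<sigma> (a k))"
      unfolding occurs_at_def by blast
    then show "\<exists>i. ?occ i \<and> \<rho> ` A = i ` {1..r}"
      by (intro exI[of _ "\<rho> \<circ> a"]) (simp add: inv image_comp)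
  qed
  have "{I. I \<subseteq> {1..n} \<and> (\<exists>i. ?occ i \<and> I = i ` {1..r})} = (`) \<rho> ` {A. A \<subseteq> {1..n} \<and> occurs_at r \<pi> \<sigma> \<rho> A}"
  proof (intro set_eqI iffI)
    fix I assume I: "I \<in> {I. I \<subseteq> {1..n} \<and> (\<exists>i. ?occ i \<and> I = i ` {1..r})}"
    have I': "I = \<rho> ` inv \<rho> ` I" by (simp add: image_image inv)
    moreover have "inv \<rho> ` I \<subseteq> {1..n}" using I permutes_image[OF permutes_inv[OF \<rho>]] by blast
    moreover have "occurs_at r \<pi> \<sigma> \<rho> (inv \<rho> ` I)"
      unfolding eq[symmetric] I'[symmetric] using I by blast
    ultimately show "I \<in> (`) \<rho> ` {A. A \<subseteq> {1..n} \<and> occurs_at r \<pi> \<sigma> \<rho> A}" by blast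
  next
    fix I assume "I \<in> (`) \<rho> ` {A. A \<subseteq> {1..n} \<and> occurs_at r \<pi> \<sigma> \<rho> A}"
    then obtain A where "I = \<rho> ` A" "A \<subseteq> {1..n}" "occurs_at r \<pi> \<sigma> \<rho> A" by blast
    then show "I \<in> {I. I \<subseteq> {1..n} \<and> (\<exists>i. ?occ i \<and> I = i ` {1..r})}"
      using permutes_image[OF \<rho>] eq[of A] by blast
  qed
  moreover have "inj_on ((`) \<rho>) X" for X
    using permutes_inj[OF \<rho>] by (auto simp: inj_on_def inj_image_eq_iff)
  ultimately have "card {I. I \<subseteq> {1..n} \<and> (\<exists>i. ?occ i \<and> I = i ` {1..r})} = label_count r \<pi> n \<sigma> \<rho>"
    unfolding label_count_def by (simp add: card_image)
  moreover have "{I. I \<subseteq> {1..n} \<and> (\<exists>i. ?occ i \<and> I = i ` {1..r})} =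
     {I. I \<subseteq> {1..n} \<and> (\<exists>i. strict_mono_on {1..r} i \<and> I = i ` {1..r} \<and>
        (\<forall>j\<in>{1..r}. \<forall>k\<in>{1..r}. \<pi> j > \<pi> k \<longleftrightarrow> (\<rho> \<circ> \<sigma> \<circ> inv \<rho>) (i j) > (\<rho> \<circ> \<sigma> \<circ> inv \<rho>) (i k)))}"
    by blast
  ultimately show ?thesis unfolding pattern_count_def by simp
qed

lemma ranks_exist:
  fixes u :: "nat \<Rightarrow> nat"
  assumes inj: "inj_on u {1..n}"
  shows "\<exists>\<rho>. \<rho> permutes {1..n} \<and> (\<forall>i\<in>{1..n}. \<forall>j\<in>{1..n}. \<rho> i < \<rho> j \<longleftrightarrow> u i < u j)"
proof -
  define \<rho> where "\<rho> i = (if i \<in> {1..n} then card {j \<in> {1..n}. u j \<le> u i} else i)" for i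
  have less: "\<rho> i < \<rho> j" if "i \<in> {1..n}" "j \<in> {1..n}" "u i < u j" for i j
  proof -
    have "{k \<in> {1..n}. u k \<le> u i} \<subset> {k \<in> {1..n}. u k \<le> u j}"
    proof (rule psubsetI)
      have "j \<notin> {k \<in> {1..n}. u k \<le> u i}" "j \<in> {k \<in> {1..n}. u k \<le> u j}" using that by auto
      then show "{k \<in> {1..n}. u k \<le> u i} \<noteq> {k \<in> {1..n}. u k \<le> u j}" by metis
      show "{k \<in> {1..n}. u k \<le> u i} \<subseteq> {k \<in> {1..n}. u k \<le> u j}" using that by force
    qed
    then have "card {k \<in> {1..n}. u k \<le> u i} < card {k \<in> {1..n}. u k \<le> u j}" by (intro psubset_card_mono) auto
    then show ?thesis using that by (simp only: \<rho>_def if_True)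
  qed
  have iff: "\<rho> i < \<rho> j \<longleftrightarrow> u i < u j" if "i \<in> {1..n}" "j \<in> {1..n}" for i j
    using less[OF that] less[OF that(2,1)] inj_onD[OF inj _ that] by (metis less_asym less_irrefl linorder_neqE_nat)
  have "inj_on \<rho> {1..n}"
  proof (rule inj_onI)
    fix i j assume ij: "i \<in> {1..n}" "j \<in> {1..n}" "\<rho> i = \<rho> j"
    then have "u i = u j" using less[OF ij(1,2)] less[OF ij(2,1)] by (metis less_irrefl linorder_neqE_nat)
    then show "i = j" using inj_onD[OF inj] ij by blast
  qed
  moreover have "\<rho> ` {1..n} \<subseteq> {1..n}"
  proof (rule image_subsetI)
    fix i assume i: "i \<in> {1..n}"
    have "{j \<in> {1..n}. u j \<le> u i} \<subseteq> {1..n}" by blast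
    then have "card {j \<in> {1..n}. u j \<le> u i} \<le> n" using card_mono[of "{1..n}"] by fastforce
    moreover have "card {j \<in> {1..n}. u j \<le> u i} > 0" using i by (subst card_gt_0_iff) auto
    ultimately show "\<rho> i \<in> {1..n}" using i by (simp add: \<rho>_def)
  qed
  ultimately have "bij_betw \<rho> {1..n} {1..n}" by (simp add: bij_betw_def endo_inj_surj)
  then have "\<rho> permutes {1..n}" by (rule bij_imp_permutes) (auto simp: \<rho>_def)
  with iff show ?thesis by blast
qed

section \<open>Tie-free labels and uniform permutations\<close>

definition tie_free :: "nat \<Rightarrow> nat \<Rightarrow> (nat \<Rightarrow> nat) set" where
  "tie_free n N = {u \<in> {1..n} \<rightarrow>\<^sub>E {..<N}. inj_on u {1..n}}"

lemma finite_tie_free: "finite (tie_free n N)"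
  unfolding tie_free_def by (rule finite_subset[OF _ finite_PiE[of "{1..n}" "\<lambda>_. {..<N}"]]) auto

lemma tie_free_comp:
  assumes "u \<in> tie_free n N" "s permutes {1..n}"
  shows "u \<circ> s \<in> tie_free n N"
proof -
  have "s i \<in> {1..n} \<longleftrightarrow> i \<in> {1..n}" for i using permutes_in_image[OF assms(2)] .
  moreover have "s i = i" if "i \<notin> {1..n}" for i using permutes_not_in[OF assms(2) that] .
  moreover have "inj_on (u \<circ> s) {1..n}"
    using assms permutes_image[OF assms(2)] permutes_inj_on[OF assms(2)] by (intro comp_inj_on) (auto simp: tie_free_def)
  ultimately show ?thesis using assms(1) by (auto simp: tie_free_def PiE_iff extensional_def)
qed

text \<open>
  Tie-free labels are exchangeable, so one may permute them by a further uniform \<open>s\<close>.  For fixed labels with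
  ranks \<open>\<rho>\<close>, the permuted labels are ordered like \<open>\<rho> \<circ> s\<close>, which is again uniform.
\<close>

lemma avg_tie_free:
  assumes \<sigma>: "\<sigma> permutes {1..n}" and ne: "tie_free n N \<noteq> {}"
  shows "avg (tie_free n N) (\<lambda>u. F (label_count r \<pi> n \<sigma> u))
    = avg {\<rho>. \<rho> permutes {1..n}} (\<lambda>\<rho>. F (label_count r \<pi> n \<sigma> \<rho>))"
proof -
  let ?S = "{\<rho>. \<rho> permutes {1..n}}" and ?I = "tie_free n N" and ?G = "\<lambda>u. F (label_count r \<pi> n \<sigma> u)"
  have S: "finite ?S" "?S \<noteq> {}" using finite_permutations[of "{1..n}"] permutes_id[of "{1..n}"] by (simp, blast)
  have shift: "avg ?I ?G = avg ?I (\<lambda>u. ?G (u \<circ> s))" if s: "s \<in> ?S" for s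
  proof (rule avg_bij, rule bij_betw_byWitness[where f' = "\<lambda>u. u \<circ> inv s"])
    show "(\<lambda>u. u \<circ> s) ` ?I \<subseteq> ?I" using tie_free_comp s by blast
    show "(\<lambda>u. u \<circ> inv s) ` ?I \<subseteq> ?I" using tie_free_comp permutes_inv s by blast
  qed (use s in \<open>simp_all add: fun_eq_iff permutes_inverses[of s "{1..n}"]\<close>)
  have inner: "avg ?S (\<lambda>s. ?G (u \<circ> s)) = avg ?S ?G" if u: "u \<in> ?I" for u
  proof -
    obtain \<rho> where \<rho>: "\<rho> permutes {1..n}" "\<And>i j. i \<in> {1..n} \<Longrightarrow> j \<in> {1..n} \<Longrightarrow> \<rho> i < \<rho> j \<longleftrightarrow> u i < u j"
      using ranks_exist[of u n] u unfolding tie_free_def by blast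
    have "bij_betw (\<lambda>s. \<rho> \<circ> s) ?S ?S"
    proof (rule bij_betw_byWitness[where f' = "\<lambda>s. inv \<rho> \<circ> s"])
      show "(\<lambda>s. \<rho> \<circ> s) ` ?S \<subseteq> ?S" by (intro image_subsetI) (simp only: mem_Collect_eq permutes_compose[OF _ \<rho>(1)])
      show "(\<lambda>s. inv \<rho> \<circ> s) ` ?S \<subseteq> ?S" by (intro image_subsetI) (simp only: mem_Collect_eq permutes_compose[OF _ permutes_inv[OF \<rho>(1)]])
    qed (simp_all add: fun_eq_iff permutes_inverses[OF \<rho>(1)])
    from avg_bij[OF this] have "avg ?S ?G = avg ?S (\<lambda>s. ?G (\<rho> \<circ> s))" .
    also have "\<dots> = avg ?S (\<lambda>s. ?G (u \<circ> s))"
    proof (rule avg_cong)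
      fix s assume "s \<in> ?S"
      then have "s i \<in> {1..n}" if "i \<in> {1..n}" for i using that permutes_in_image[of s "{1..n}" i] by simp
      then show "?G (\<rho> \<circ> s) = ?G (u \<circ> s)"
        using label_count_cong[OF \<sigma>, of "\<rho> \<circ> s" "u \<circ> s"] \<rho>(2) by simp
    qed
    finally show ?thesis ..
  qed
  have "avg ?I ?G = avg ?S (\<lambda>s. avg ?I ?G)" using S by (simp add: avg_const)
  also have "\<dots> = avg ?S (\<lambda>s. avg ?I (\<lambda>u. ?G (u \<circ> s)))" by (rule avg_cong) (rule shift)
  also have "\<dots> = avg ?I (\<lambda>u. avg ?S (\<lambda>s. ?G (u \<circ> s)))" by (rule avg_swap)
  also have "\<dots> = avg ?I (\<lambda>_. avg ?S ?G)" by (rule avg_cong) (rule inner)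
  also have "\<dots> = avg ?S ?G" using finite_tie_free ne by (rule avg_const)
  finally show ?thesis .
qed

lemma card_tie_free_ge: "card (tie_free n N) \<ge> (N - n) ^ n"
proof -
  have "card (tie_free n N) = (\<Prod>i = 0..<n. N - i)"
    using card_inj_on_subset_funcset[of "{1..n}" "{..<N}" "{1..n}"] by (simp add: tie_free_def)
  moreover have "(\<Prod>i = 0..<n. N - n) \<le> (\<Prod>i = 0..<n. N - i)" by (rule prod_mono) auto
  ultimately show ?thesis by simp
qed

lemma label_count_le: "label_count r \<pi> n \<sigma> u \<le> 2 ^ n"
proof -
  have "{A. A \<subseteq> {1..n} \<and> occurs_at r \<pi> \<sigma> u A} \<subseteq> Pow {1..n}" by blast
  from card_mono[OF _ this] show ?thesis by (simp add: label_count_def card_Pow)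
qed

text \<open>
  The proportion of labellings with a tie is at most \<open>1 - ((N - n) / N) ^ n\<close>, which tends to 0, and \<open>F\<close> is
  bounded on the finitely many possible values of the count.
\<close>

lemma avg_ties_vanish:
  assumes \<sigma>: "\<sigma> permutes {1..n}"
  shows "(\<lambda>N. avg ({1..n} \<rightarrow>\<^sub>E {..<N}) (\<lambda>u. F (label_count r \<pi> n \<sigma> u)))
     \<longlonglongrightarrow> avg {\<rho>. \<rho> permutes {1..n}} (\<lambda>\<rho>. F (label_count r \<pi> n \<sigma> \<rho>))"
    (is "?a \<longlonglongrightarrow> ?L")
proof -
  define K where "K = (\<Sum>m\<le>2 ^ n. \<bar>F m\<bar>)"
  have K: "\<bar>F (label_count r \<pi> n \<sigma> u)\<bar> \<le> K" for u
    unfolding K_def using label_count_le by (intro member_le_sum) auto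
  have bound: "\<bar>?a N - ?L\<bar> \<le> 2 * K * (1 - (real (N - n) / real N) ^ n)" if N: "N > n" for N
  proof -
    let ?P = "{1..n} \<rightarrow>\<^sub>E {..<N}" and ?I = "tie_free n N" and ?G = "\<lambda>u. F (label_count r \<pi> n \<sigma> u)"
    have finP: "finite ?P" by (intro finite_PiE) auto
    have sub: "?I \<subseteq> ?P" by (auto simp: tie_free_def)
    have cP: "card ?P = N ^ n" by (simp add: card_PiE)
    have cI: "card ?I \<ge> (N - n) ^ n" by (rule card_tie_free_ge)
    have "(N - n) ^ n > 0" using N by simp
    then have cI0: "card ?I > 0" using cI by linarith
    then have neI: "?I \<noteq> {}" by (metis card.empty less_irrefl)
    have L: "?L = avg ?I ?G" using avg_tie_free[OF \<sigma> neI] by simp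
    have IL: "(\<Sum>u\<in>?I. ?G u) = card ?I * ?L" using cI0 unfolding L by (simp add: avg_def)
    have "\<bar>avg ?I ?G\<bar> \<le> K"
    proof -
      have "\<bar>\<Sum>u\<in>?I. ?G u\<bar> \<le> (\<Sum>u\<in>?I. K)" using K by (intro order_trans[OF sum_abs] sum_mono)
      then show ?thesis using cI0 by (simp add: avg_def divide_simps mult.commute)
    qed
    then have LK: "\<bar>?L\<bar> \<le> K" unfolding L .
    have "(\<Sum>u\<in>?P. ?G u) = (\<Sum>u\<in>?I. ?G u) + (\<Sum>u\<in>?P - ?I. ?G u)"
      using sum.subset_diff[OF sub finP, of ?G] by simp
    then have "(\<Sum>u\<in>?P. ?G u) - card ?P * ?L = (\<Sum>u\<in>?P - ?I. ?G u) - (real (card ?P) - card ?I) * ?L"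
      unfolding IL by (simp add: algebra_simps)
    also have "\<bar>\<dots>\<bar> \<le> (real (card ?P) - card ?I) * K + (real (card ?P) - card ?I) * K"
    proof (intro order_trans[OF abs_triangle_ineq4] add_mono)
      have c: "real (card (?P - ?I)) = real (card ?P) - card ?I"
        using sub finP by (simp add: card_Diff_subset finite_tie_free card_mono of_nat_diff)
      have "\<bar>\<Sum>u\<in>?P - ?I. ?G u\<bar> \<le> (\<Sum>u\<in>?P - ?I. K)" using K by (intro order_trans[OF sum_abs] sum_mono)
      then show "\<bar>\<Sum>u\<in>?P - ?I. ?G u\<bar> \<le> (real (card ?P) - card ?I) * K" by (simp only: sum_constant c)
      have "0 \<le> real (card ?P) - card ?I" using c by (metis of_nat_0_le_iff)
      then show "\<bar>(real (card ?P) - card ?I) * ?L\<bar> \<le> (real (card ?P) - card ?I) * K"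
        using LK by (simp add: abs_mult mult_left_mono)
    qed
    finally have "\<bar>(\<Sum>u\<in>?P. ?G u) - card ?P * ?L\<bar> / card ?P \<le> 2 * K * (real (card ?P) - card ?I) / card ?P"
      by (intro divide_right_mono) (auto simp: algebra_simps)
    moreover have "?a N - ?L = ((\<Sum>u\<in>?P. ?G u) - card ?P * ?L) / card ?P"
    proof -
      have nz: "real (card ?P) \<noteq> 0" using N unfolding cP by simp
      show ?thesis unfolding avg_def[of ?P] diff_divide_distrib nonzero_mult_div_cancel_left[OF nz] ..
    qed
    moreover have "2 * K * (real (card ?P) - card ?I) / card ?P \<le> 2 * K * (1 - (real (N - n) / real N) ^ n)"
    proof -
      have "real (card ?I) \<ge> real (N - n) ^ n" using cI by (metis of_nat_le_iff of_nat_power)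
      then have "(real (card ?P) - card ?I) / card ?P \<le> 1 - (real (N - n) / real N) ^ n"
        using N unfolding cP by (simp add: power_divide divide_simps)
      moreover have "K \<ge> 0" unfolding K_def by (intro sum_nonneg) auto
      ultimately have "2 * K * ((real (card ?P) - card ?I) / card ?P) \<le> 2 * K * (1 - (real (N - n) / real N) ^ n)"
        by (intro mult_left_mono) auto
      then show ?thesis by simp
    qed
    ultimately show ?thesis by simp
  qed
  have "\<forall>\<^sub>F N in sequentially. norm (?a N - ?L) \<le> 2 * K * (1 - (real (N - n) / real N) ^ n)"
    unfolding real_norm_def using eventually_gt_at_top[of n] bound by (rule eventually_mono)
  moreover have "(\<lambda>N. 2 * K * (1 - (real (N - n) / real N) ^ n)) \<longlonglongrightarrow> 2 * K * (1 - 1 ^ n)"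
  proof (intro tendsto_intros)
    have "(\<lambda>N. (real N - real n) / real N) \<longlonglongrightarrow> 1" by real_asymp
    then show "(\<lambda>N. real (N - n) / real N) \<longlonglongrightarrow> 1"
      by (rule Lim_transform_eventually) (rule eventually_mono[OF eventually_ge_at_top[of n]], simp add: of_nat_diff)
  qed
  then have "(\<lambda>N. 2 * K * (1 - (real (N - n) / real N) ^ n)) \<longlonglongrightarrow> 0" by simp
  ultimately have "(\<lambda>N. ?a N - ?L) \<longlonglongrightarrow> 0" by (rule Lim_null_comparison)
  then show ?thesis by (simp add: LIM_zero_iff)
qed

section \<open>First and second differences of the pattern count\<close>

lemma occurs_at_upd:
  assumes "i \<notin> A \<union> \<sigma> ` A"
  shows "occurs_at r \<pi> \<sigma> (u(i := a)) A = occurs_at r \<pi> \<sigma> u A"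
  by (rule occurs_at_cong) (use assms in \<open>metis fun_upd_other\<close>)

definition r_subsets :: "nat \<Rightarrow> nat \<Rightarrow> nat set set" where
  "r_subsets n r = {A. A \<subseteq> {1..n} \<and> card A = r}"

lemma finite_r_subsets: "finite (r_subsets n r)"
  unfolding r_subsets_def by (rule finite_subset[of _ "Pow {1..n}"]) auto

lemma label_count_sum:
  "real (label_count r \<pi> n \<sigma> u) = (\<Sum>A\<in>r_subsets n r. of_bool (occurs_at r \<pi> \<sigma> u A))"
proof -
  have "{A. A \<subseteq> {1..n} \<and> occurs_at r \<pi> \<sigma> u A} = {A \<in> r_subsets n r. occurs_at r \<pi> \<sigma> u A}"
    using occurs_at_card[of r \<pi> \<sigma> u] by (auto simp: r_subsets_def)
  then have "real (label_count r \<pi> n \<sigma> u) = (\<Sum>A | A \<in> r_subsets n r \<and> occurs_at r \<pi> \<sigma> u A. 1)"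
    by (simp add: label_count_def)
  also have "\<dots> = (\<Sum>A\<in>r_subsets n r. of_bool (occurs_at r \<pi> \<sigma> u A))"
    unfolding of_bool_def by (rule sum.inter_filter[OF finite_r_subsets])
  finally show ?thesis .
qed

text \<open>
  Removing \<open>K\<close> embeds these sets into the subsets of \<open>{1..n}\<close> with \<open>r - card K\<close> elements.
\<close>

lemma card_supersets_le:
  assumes "finite K" "card K \<le> r"
  shows "real (card {A \<in> r_subsets n r. K \<subseteq> A}) \<le> real n ^ (r - card K) / fact (r - card K)"
proof -
  let ?X = "{A \<in> r_subsets n r. K \<subseteq> A}" and ?Y = "{B. B \<subseteq> {1..n} \<and> card B = r - card K}"
  have "inj_on (\<lambda>A. A - K) ?X"
    by (rule inj_onI) (use Un_Diff_cancel2 in \<open>metis (mono_tags, lifting) Un_absorb1 Un_commute mem_Collect_eq\<close>)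
  moreover have "(\<lambda>A. A - K) ` ?X \<subseteq> ?Y"
    using assms(1) by (auto simp: r_subsets_def card_Diff_subset)
  moreover have "finite ?Y" by (rule finite_subset[of _ "Pow {1..n}"]) auto
  ultimately have "card ?X \<le> card ?Y" by (rule card_inj_on_le)
  also have "card ?Y = n choose (r - card K)" using n_subsets[of "{1..n}" "r - card K"] by simp
  finally have "real (card ?X) \<le> real (n choose (r - card K))" by simp
  also have "\<dots> \<le> real n ^ (r - card K) / fact (r - card K)"
  proof -
    have "real ((n choose (r - card K)) * fact (r - card K)) \<le> real (n ^ (r - card K))"
      using binomial_fact_pow[of n "r - card K"] by (simp only: of_nat_le_iff)
    then show ?thesis by (simp add: field_simps)
  qed
  finally show ?thesis .
qed

lemma abs_of_bool_diff_le: "\<bar>of_bool p - of_bool q :: real\<bar> \<le> 1"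
  by auto

text \<open>
  The label \<open>u i\<close> is a coordinate of the points with index \<open>i\<close> and \<open>\<sigma>\<inverse> i\<close> only, and each of these lies in at
  most \<open>n ^ (r - 1) / (r - 1)!\<close> of the sets.
\<close>

lemma label_count_first_diff:
  assumes \<sigma>: "\<sigma> permutes {1..n}" and r: "r \<ge> 1"
  shows "\<bar>real (label_count r \<pi> n \<sigma> u) - real (label_count r \<pi> n \<sigma> (u(i := a)))\<bar>
    \<le> 2 * (real n ^ (r - 1) / fact (r - 1))"
proof -
  let ?R = "r_subsets n r" and ?K = "\<lambda>k. {A \<in> r_subsets n r. {k} \<subseteq> A}"
  let ?\<phi> = "\<lambda>u A. of_bool (occurs_at r \<pi> \<sigma> u A) :: real"
  have touch: "A \<in> ?K i \<union> ?K (inv \<sigma> i)" if "A \<in> ?R" "i \<in> A \<union> \<sigma> ` A" for A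
    using that(2)
  proof
    assume "i \<in> A"
    then show ?thesis using that(1) by blast
  next
    assume "i \<in> \<sigma> ` A"
    then have "inv \<sigma> i \<in> A" by (auto simp: permutes_inverses[OF \<sigma>])
    then show ?thesis using that(1) by blast
  qed
  have "\<bar>real (label_count r \<pi> n \<sigma> u) - real (label_count r \<pi> n \<sigma> (u(i := a)))\<bar>
      \<le> (\<Sum>A\<in>?R. \<bar>?\<phi> u A - ?\<phi> (u(i := a)) A\<bar>)"
    unfolding label_count_sum sum_subtractf[symmetric] by (rule sum_abs)
  also have "\<dots> = (\<Sum>A\<in>?K i \<union> ?K (inv \<sigma> i). \<bar>?\<phi> u A - ?\<phi> (u(i := a)) A\<bar>)"
  proof (rule sum.mono_neutral_right[OF finite_r_subsets])
    show "\<forall>A\<in>?R - (?K i \<union> ?K (inv \<sigma> i)). \<bar>?\<phi> u A - ?\<phi> (u(i := a)) A\<bar> = 0"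
    proof
      fix A assume "A \<in> ?R - (?K i \<union> ?K (inv \<sigma> i))"
      then have "i \<notin> A \<union> \<sigma> ` A" using touch[of A] by (meson DiffE)
      from occurs_at_upd[OF this] show "\<bar>?\<phi> u A - ?\<phi> (u(i := a)) A\<bar> = 0" by simp
    qed
  qed auto
  also have "\<dots> \<le> (\<Sum>A\<in>?K i \<union> ?K (inv \<sigma> i). 1)" by (rule sum_mono) (rule abs_of_bool_diff_le)
  also have "\<dots> = real (card (?K i \<union> ?K (inv \<sigma> i)))" by (rule real_of_card[symmetric])
  also have "\<dots> \<le> real (card (?K i)) + real (card (?K (inv \<sigma> i)))"
    unfolding of_nat_add[symmetric] of_nat_le_iff by (rule card_Un_le)
  also have "\<dots> \<le> real n ^ (r - 1) / fact (r - 1) + real n ^ (r - 1) / fact (r - 1)"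
    using card_supersets_le[of "{i}" r n] card_supersets_le[of "{inv \<sigma> i}" r n] r by (intro add_mono) simp_all
  finally show ?thesis by simp
qed

text \<open>
  For \<open>r = 1\<close> both sides vanish; for larger \<open>r\<close> the right-hand side is \<open>n * n ^ (r - 2) / (r - 2)!\<close>, written
  in terms of the first-difference scale.
\<close>

lemma pair_supersets_le:
  assumes "k \<noteq> l" "n \<ge> 1" "r \<ge> 1"
  shows "real n * card {A \<in> r_subsets n r. {k, l} \<subseteq> A} \<le> real (r - 1) * (real n ^ (r - 1) / fact (r - 1))"
proof (cases "r = 1")
  case True
  have none: "{A \<in> r_subsets n r. {k, l} \<subseteq> A} = {}"
  proof -
    have "card {k, l} \<le> card A" if "A \<in> r_subsets n r" "{k, l} \<subseteq> A" for A
    proof (rule card_mono[OF _ that(2)])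
      have "A \<subseteq> {1..n}" using that(1) by (simp add: r_subsets_def)
      then show "finite A" by (rule finite_subset) simp
    qed
    then show ?thesis using assms True by (force simp: r_subsets_def)
  qed
  show ?thesis unfolding none using True by simp
next
  case False
  then obtain q where q: "r = Suc (Suc q)" using assms(3) by (metis One_nat_def not0_implies_Suc not_one_le_zero)
  have "real n * card {A \<in> r_subsets n r. {k, l} \<subseteq> A} \<le> real n * (real n ^ q / fact q)"
    using card_supersets_le[of "{k, l}" r n] assms q by (intro mult_left_mono) auto
  also have "\<dots> = real (r - 1) * (real n ^ (r - 1) / fact (r - 1))"
    by (simp add: q field_simps del: of_nat_Suc)
  finally show ?thesis .
qed

text \<open>
  A set contributes only if it contains a point involving the label \<open>i\<close> and a point involving the label
  \<open>j\<close>.  As \<open>i\<close> and \<open>j\<close> are not adjacent, these are four pairs of distinct points, and each set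
  contributes at most 2.
\<close>

lemma label_count_second_diff:
  assumes \<sigma>: "\<sigma> permutes {1..n}" and r: "r \<ge> 1" and n: "n \<ge> 1" and ij: "i \<notin> {j, \<sigma> j, inv \<sigma> j}"
  shows "\<bar>real (label_count r \<pi> n \<sigma> u) - real (label_count r \<pi> n \<sigma> (u(i := a)))
      - real (label_count r \<pi> n \<sigma> (u(j := a'))) + real (label_count r \<pi> n \<sigma> (u(i := a, j := a')))\<bar>
    \<le> 8 * real (r - 1) / real n * (real n ^ (r - 1) / fact (r - 1))"
proof -
  let ?R = "r_subsets n r" and ?K = "\<lambda>k l. {A \<in> r_subsets n r. {k, l} \<subseteq> A}"
  let ?\<phi> = "\<lambda>u A. of_bool (occurs_at r \<pi> \<sigma> u A) :: real"
  let ?d = "\<lambda>A. ?\<phi> u A - ?\<phi> (u(i := a)) A - ?\<phi> (u(j := a')) A + ?\<phi> (u(i := a, j := a')) A"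
  define i' j' where "i' = inv \<sigma> i" and "j' = inv \<sigma> j"
  have inv: "inv \<sigma> (\<sigma> x) = x" "\<sigma> (inv \<sigma> x) = x" for x using permutes_inverses[OF \<sigma>] by auto
  have dis: "i \<noteq> j" "i \<noteq> j'" "i' \<noteq> j" "i' \<noteq> j'"
  proof -
    show "i \<noteq> j" "i \<noteq> j'" using ij by (auto simp: j'_def)
    show "i' \<noteq> j" using ij inv(2)[of i] by (auto simp: i'_def)
    show "i' \<noteq> j'" using \<open>i \<noteq> j\<close> inv(2)[of i] inv(2)[of j] by (auto simp: i'_def j'_def)
  qed
  define U where "U = (?K i j \<union> ?K i j') \<union> (?K i' j \<union> ?K i' j')"
  have touch: "A \<in> U" if "A \<in> ?R" "i \<in> A \<union> \<sigma> ` A" "j \<in> A \<union> \<sigma> ` A" for A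
  proof -
    have "i \<in> A \<or> i' \<in> A" using that(2) by (auto simp: i'_def inv)
    moreover have "j \<in> A \<or> j' \<in> A" using that(3) by (auto simp: j'_def inv)
    ultimately show ?thesis using that(1) unfolding U_def by blast
  qed
  have "\<bar>real (label_count r \<pi> n \<sigma> u) - real (label_count r \<pi> n \<sigma> (u(i := a)))
      - real (label_count r \<pi> n \<sigma> (u(j := a'))) + real (label_count r \<pi> n \<sigma> (u(i := a, j := a')))\<bar>
      \<le> (\<Sum>A\<in>?R. \<bar>?d A\<bar>)"
    unfolding label_count_sum sum_subtractf[symmetric] sum.distrib[symmetric] by (rule sum_abs)
  also have "\<dots> = (\<Sum>A\<in>U. \<bar>?d A\<bar>)"
  proof (rule sum.mono_neutral_right[OF finite_r_subsets])
    show "\<forall>A\<in>?R - U. \<bar>?d A\<bar> = 0"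
    proof
      fix A assume "A \<in> ?R - U"
      then consider "i \<notin> A \<union> \<sigma> ` A" | "j \<notin> A \<union> \<sigma> ` A" using touch[of A] by (meson DiffE)
      then show "\<bar>?d A\<bar> = 0"
      proof cases
        case 1
        then show ?thesis unfolding fun_upd_twist[OF dis(1)] using occurs_at_upd[OF 1] by simp
      next
        case 2
        then show ?thesis using occurs_at_upd[OF 2] by simp
      qed
    qed
  qed (auto simp: U_def)
  also have "\<dots> \<le> (\<Sum>A\<in>U. 2)"
  proof (rule sum_mono)
    fix A
    show "\<bar>?d A\<bar> \<le> 2" by auto
  qed
  also have "\<dots> = 2 * real (card U)" by simp
  also have "\<dots> \<le> 2 * (4 * (real (r - 1) * (real n ^ (r - 1) / fact (r - 1)) / real n))"
  proof -
    have K: "real (card (?K k l)) \<le> real (r - 1) * (real n ^ (r - 1) / fact (r - 1)) / real n" if "k \<noteq> l" for k l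
      using pair_supersets_le[OF that n r] n by (simp add: field_simps)
    have "card U \<le> (card (?K i j) + card (?K i j')) + (card (?K i' j) + card (?K i' j'))"
      unfolding U_def by (intro order_trans[OF card_Un_le] add_mono card_Un_le)
    then have "real (card U) \<le> real (card (?K i j)) + real (card (?K i j')) + (real (card (?K i' j)) + real (card (?K i' j')))"
      by (simp only: of_nat_add[symmetric] of_nat_le_iff)
    then show ?thesis using K[OF dis(1)] K[OF dis(2)] K[OF dis(3)] K[OF dis(4)] by linarith
  qed
  also have "\<dots> = 8 * real (r - 1) / real n * (real n ^ (r - 1) / fact (r - 1))" by (simp add: mult_ac)
  finally show ?thesis .
qed

section \<open>Normal approximation of the pattern count\<close>

text \<open>
  With \<open>b = 2 * M\<close>, \<open>m = 3\<close> and \<open>n * \<beta> = 8 * (r - 1) * M\<close>, the bound by differences is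
  \<open>3 / 2 * sqrt (n / 2) * (24 + 32 * (r - 1)) * M\<^sup>2 / V\<close>, which is at most
  \<open>48 / sqrt 2 * r * M\<^sup>2 * sqrt n / V\<close>, and \<open>48 / sqrt 2 < 42\<close>.
\<close>

lemma label_count_kolmogorov_bound:
  fixes \<sigma> \<pi> :: "nat \<Rightarrow> nat"
  assumes \<sigma>: "\<sigma> permutes {1..n}" and r: "r \<ge> 1" and N: "N > 0" and n: "n \<ge> 1"
  defines "Q \<equiv> {1..n} \<rightarrow>\<^sub>E {..<N}" and "f \<equiv> \<lambda>u. real (label_count r \<pi> n \<sigma> u)"
  defines "V \<equiv> avg Q (\<lambda>u. (f u)\<^sup>2) - (avg Q f)\<^sup>2"
  assumes V: "V > 0"
  shows "\<bar>avg Q (\<lambda>u. of_bool (f u \<le> y)) - gauss_cdf ((y - avg Q f) / sqrt V)\<bar>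
    \<le> 42 * real r * (real n ^ (r - 1) / fact (r - 1))\<^sup>2 * sqrt n / V"
proof -
  interpret iid_coordinates n "{..<N}" by standard (use N in auto)
  have P: "iid_coordinates.P n {..<N} = Q" by (simp add: P_def Q_def)
  define M where "M = real n ^ (r - 1) / fact (r - 1)"
  define \<beta> where "\<beta> = 8 * real (r - 1) / real n * M"
  have M: "M \<ge> 0" by (simp add: M_def)
  have Var: "Var1 f = V" unfolding Var1_def V_def P ..
  have "\<bar>avg Q (\<lambda>u. indicator {..(y - avg Q f) / sqrt V} ((f u - avg Q f) / sqrt V)) - gauss_cdf ((y - avg Q f) / sqrt V)\<bar>
    \<le> 3 / 2 * sqrt (n / 2) * (2 * 3 * (2 * M)\<^sup>2 + 2 * n * (2 * M) * \<beta>) / V"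
    unfolding P[symmetric]
    unfolding Var[symmetric]
  proof (rule order_trans[OF kolmogorov_bound_by_differences[where b = "2 * M" and \<beta> = \<beta> and m = 3 and Adj = "\<lambda>j. {j, \<sigma> j, inv \<sigma> j}"]])
    show "card {j, \<sigma> j, inv \<sigma> j} \<le> 3" for j
      using card_length[of "[j, \<sigma> j, inv \<sigma> j]"] by simp
    show "\<bar>f x - f (x(i := a))\<bar> \<le> 2 * M" for x i a
      unfolding f_def M_def by (rule label_count_first_diff[OF \<sigma> r])
    show "\<bar>f x - f (x(i := a)) - f (x(j := a')) + f (x(i := a, j := a'))\<bar> \<le> \<beta>" if "i \<notin> {j, \<sigma> j, inv \<sigma> j}" for x i j a a'
      unfolding f_def M_def \<beta>_def by (rule label_count_second_diff[OF \<sigma> r n that])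
  qed (use V Var M in \<open>auto simp: \<beta>_def\<close>)
  also have "\<dots> \<le> 42 * real r * M\<^sup>2 * sqrt n / V"
  proof (rule divide_right_mono)
    \<comment> \<open>The adjacent indices contribute \<open>24 \<le> 32\<close>, which is absorbed in replacing \<open>r - 1\<close> by \<open>r\<close>.\<close>
    have "2 * n * (2 * M) * \<beta> = 32 * real (r - 1) * M\<^sup>2"
      using n by (simp add: \<beta>_def power2_eq_square)
    then have "2 * 3 * (2 * M)\<^sup>2 + 2 * n * (2 * M) * \<beta> = (24 + 32 * real (r - 1)) * M\<^sup>2"
      by (simp add: algebra_simps)
    also have "\<dots> \<le> 32 * real r * M\<^sup>2" using r by (intro mult_right_mono) auto
    finally have "3 / 2 * sqrt (n / 2) * (2 * 3 * (2 * M)\<^sup>2 + 2 * n * (2 * M) * \<beta>)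
      \<le> 3 / 2 * sqrt (n / 2) * (32 * real r * M\<^sup>2)" by (intro mult_left_mono) auto
    also have "\<dots> = (48 * sqrt (1 / 2)) * (real r * M\<^sup>2 * sqrt n)"
      by (simp add: real_sqrt_divide)
    also have "\<dots> \<le> 42 * (real r * M\<^sup>2 * sqrt n)"
    proof (rule mult_right_mono)
      have "sqrt (1 / 2) \<le> sqrt ((42 / 48)\<^sup>2)" by (rule real_sqrt_le_mono) (simp add: power2_eq_square)
      then show "48 * sqrt (1 / 2) \<le> 42" by simp
    qed simp
    finally show "3 / 2 * sqrt (n / 2) * (2 * 3 * (2 * M)\<^sup>2 + 2 * n * (2 * M) * \<beta>) \<le> 42 * real r * M\<^sup>2 * sqrt n"
      by (simp add: mult.assoc)
  qed (use V in simp)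
  finally have "\<bar>avg Q (\<lambda>u. indicator {..(y - avg Q f) / sqrt V} ((f u - avg Q f) / sqrt V)) - gauss_cdf ((y - avg Q f) / sqrt V)\<bar>
    \<le> 42 * real r * M\<^sup>2 * sqrt n / V" .
  moreover have "indicator {..(y - avg Q f) / sqrt V} ((f u - avg Q f) / sqrt V) = (of_bool (f u \<le> y) :: real)" for u
    using V by (simp add: indicator_def divide_le_cancel)
  ultimately show ?thesis by (simp add: M_def)
qed

text \<open>
  Let \<open>N \<rightarrow> \<infinity>\<close> at a fixed threshold \<open>y\<close>.  The normalised threshold moves with \<open>N\<close>, but the Gaussian
  distribution function is continuous.
\<close>

lemma permutation_kolmogorov_bound:
  fixes \<sigma> \<pi> :: "nat \<Rightarrow> nat"
  assumes \<sigma>: "\<sigma> permutes {1..n}" and r: "r \<ge> 1" and n: "n \<ge> 1"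
  defines "S \<equiv> {\<rho>. \<rho> permutes {1..n}}" and "f \<equiv> \<lambda>u. real (label_count r \<pi> n \<sigma> u)"
  defines "V \<equiv> avg S (\<lambda>u. (f u)\<^sup>2) - (avg S f)\<^sup>2"
  assumes V: "V > 0"
  shows "\<bar>avg S (\<lambda>u. of_bool (f u \<le> y)) - gauss_cdf ((y - avg S f) / sqrt V)\<bar>
    \<le> 42 * real r * (real n ^ (r - 1) / fact (r - 1))\<^sup>2 * sqrt n / V"
proof -
  let ?P = "\<lambda>N. {1..n} \<rightarrow>\<^sub>E {..<N}"
  define V' where "V' N = avg (?P N) (\<lambda>u. (f u)\<^sup>2) - (avg (?P N) f)\<^sup>2" for N
  have lim: "(\<lambda>N. avg (?P N) (\<lambda>u. F (f u))) \<longlonglongrightarrow> avg S (\<lambda>u. F (f u))" for F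
    using avg_ties_vanish[OF \<sigma>, of "\<lambda>m. F (real m)" r \<pi>] by (simp add: S_def f_def)
  have mean: "(\<lambda>N. avg (?P N) f) \<longlonglongrightarrow> avg S f" using lim[of "\<lambda>x. x"] by simp
  have var: "V' \<longlonglongrightarrow> V" unfolding V'_def V_def
    by (intro tendsto_intros mean lim[of "\<lambda>x. x\<^sup>2"])
  have cont: "isCont gauss_cdf x" for x by (rule DERIV_isCont[OF gauss_cdf_deriv])
  have L: "(\<lambda>N. \<bar>avg (?P N) (\<lambda>u. of_bool (f u \<le> y)) - gauss_cdf ((y - avg (?P N) f) / sqrt (V' N))\<bar>)
    \<longlonglongrightarrow> \<bar>avg S (\<lambda>u. of_bool (f u \<le> y)) - gauss_cdf ((y - avg S f) / sqrt V)\<bar>"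
    using V by (intro tendsto_rabs tendsto_diff lim[of "\<lambda>x. of_bool (x \<le> y)"] isCont_tendsto_compose[OF cont]
        tendsto_divide tendsto_const mean tendsto_real_sqrt var) simp
  have R: "(\<lambda>N. 42 * real r * (real n ^ (r - 1) / fact (r - 1))\<^sup>2 * sqrt n / V' N)
    \<longlonglongrightarrow> 42 * real r * (real n ^ (r - 1) / fact (r - 1))\<^sup>2 * sqrt n / V"
    using V by (intro tendsto_divide tendsto_const var) simp
  have "\<forall>\<^sub>F N in sequentially. V' N > 0" using order_tendstoD(1)[OF var V] .
  with eventually_gt_at_top[of 0]
  have "\<forall>\<^sub>F N in sequentially. \<bar>avg (?P N) (\<lambda>u. of_bool (f u \<le> y)) - gauss_cdf ((y - avg (?P N) f) / sqrt (V' N))\<bar>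
    \<le> 42 * real r * (real n ^ (r - 1) / fact (r - 1))\<^sup>2 * sqrt n / V' N"
  proof eventually_elim
    case (elim N)
    show ?case
      using label_count_kolmogorov_bound[OF \<sigma> r elim(1) n, of \<pi> y] elim(2) by (simp add: V'_def f_def)
  qed
  then show ?thesis by (rule tendsto_le[OF sequentially_bot R L])
qed

theorem cyclic_perms_kolmogorov_bound:
  fixes \<pi> :: "nat \<Rightarrow> nat"
  assumes t: "cycle_type n t" and r: "r \<ge> 1" and n: "n \<ge> 1"
  defines "f \<equiv> \<lambda>\<tau>. real (pattern_count r \<pi> n \<tau>)"
  defines "V \<equiv> avg (cyclic_perms n t) (\<lambda>\<tau>. (f \<tau>)\<^sup>2) - (avg (cyclic_perms n t) f)\<^sup>2"
  assumes V: "V > 0"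
  shows "\<bar>avg (cyclic_perms n t) (\<lambda>\<tau>. of_bool (f \<tau> \<le> y)) - gauss_cdf ((y - avg (cyclic_perms n t) f) / sqrt V)\<bar>
    \<le> 42 * real r * (real n ^ (r - 1) / fact (r - 1))\<^sup>2 * sqrt n / V"
proof -
  obtain \<sigma> where \<sigma>: "\<sigma> \<in> cyclic_perms n t" using cyclic_perms_nonempty[OF t] by blast
  then have per: "\<sigma> permutes {1..n}" by (simp add: cyclic_perms_def)
  have eq: "avg (cyclic_perms n t) (\<lambda>\<tau>. F (f \<tau>)) = avg {\<rho>. \<rho> permutes {1..n}} (\<lambda>\<rho>. F (real (label_count r \<pi> n \<sigma> \<rho>)))" for F
    unfolding avg_cyclic_perms[OF \<sigma>] by (rule avg_cong) (simp add: f_def pattern_count_conjugate)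
  show ?thesis
    using permutation_kolmogorov_bound[OF per r n, of \<pi> y] V
    unfolding V_def eq[of "\<lambda>x. x\<^sup>2"] eq[of "\<lambda>x. x"] eq[of "\<lambda>x. of_bool (x \<le> y)"] by simp
qed

section \<open>The laws of the normalised pattern counts\<close>

lemma expectation_random_cyclic:
  assumes "cycle_type n t"
  shows "measure_pmf.expectation (random_cyclic n t) f = avg (cyclic_perms n t) (f :: _ \<Rightarrow> real)"
  unfolding random_cyclic_def avg_def
  by (rule integral_pmf_of_set[OF cyclic_perms_nonempty[OF assms] finite_cyclic_perms])

lemma pattern_mean_avg:
  "cycle_type n t \<Longrightarrow> pattern_mean r \<pi> n t = avg (cyclic_perms n t) (\<lambda>\<tau>. real (pattern_count r \<pi> n \<tau>))"
  unfolding pattern_mean_def by (rule expectation_random_cyclic)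

lemma pattern_var_centred:
  "cycle_type n t \<Longrightarrow> pattern_var r \<pi> n t
    = avg (cyclic_perms n t) (\<lambda>\<tau>. (real (pattern_count r \<pi> n \<tau>) - pattern_mean r \<pi> n t)\<^sup>2)"
  unfolding pattern_var_def by (simp add: expectation_random_cyclic pattern_mean_avg)

lemma pattern_var_avg:
  assumes "cycle_type n t"
  shows "pattern_var r \<pi> n t = avg (cyclic_perms n t) (\<lambda>\<tau>. (real (pattern_count r \<pi> n \<tau>))\<^sup>2)
    - (avg (cyclic_perms n t) (\<lambda>\<tau>. real (pattern_count r \<pi> n \<tau>)))\<^sup>2"
  unfolding pattern_var_centred[OF assms] pattern_mean_avg[OF assms]
  by (rule avg_centred_square[OF finite_cyclic_perms cyclic_perms_nonempty[OF assms]])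

lemma cdf_scaled_pattern_law:
  assumes "cycle_type n t" "c > 0"
  shows "cdf (scaled_pattern_law r \<pi> n t c) x
    = avg (cyclic_perms n t) (\<lambda>\<tau>. of_bool (real (pattern_count r \<pi> n \<tau>) \<le> pattern_mean r \<pi> n t + c * x))"
proof -
  let ?X = "\<lambda>\<tau>. (real (pattern_count r \<pi> n \<tau>) - pattern_mean r \<pi> n t) / c"
  have "cdf (scaled_pattern_law r \<pi> n t c) x = measure_pmf.prob (random_cyclic n t) {\<tau>. ?X \<tau> \<le> x}"
    unfolding cdf_def scaled_pattern_law_def by (subst measure_distr) (auto simp: vimage_def)
  also have "\<dots> = measure_pmf.expectation (random_cyclic n t) (indicator {\<tau>. ?X \<tau> \<le> x})"
    by simp
  also have "\<dots> = avg (cyclic_perms n t) (indicator {\<tau>. ?X \<tau> \<le> x})"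
    by (rule expectation_random_cyclic[OF assms(1)])
  also have "\<dots> = avg (cyclic_perms n t) (\<lambda>\<tau>. of_bool (real (pattern_count r \<pi> n \<tau>) \<le> pattern_mean r \<pi> n t + c * x))"
    using assms(2) by (intro avg_cong) (simp add: indicator_def field_simps)
  finally show ?thesis .
qed

lemma abs_kolmogorov_dist_le:
  assumes "\<And>x. \<bar>cdf M x - cdf N x\<bar> \<le> B"
  shows "\<bar>kolmogorov_dist M N\<bar> \<le> B"
proof -
  have "bdd_above (range (\<lambda>x. \<bar>cdf M x - cdf N x\<bar>))" using assms by (intro bdd_aboveI[of _ B]) auto
  then have "0 \<le> kolmogorov_dist M N"
    unfolding kolmogorov_dist_def by (intro cSUP_upper2[of _ _ 0]) auto
  moreover have "kolmogorov_dist M N \<le> B"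
    unfolding kolmogorov_dist_def using assms by (intro cSUP_least) auto
  ultimately show ?thesis by simp
qed

text \<open>
  The identity is the only permutation of the empty set, so every statistic is constant for \<open>n = 0\<close>.
\<close>

lemma pattern_var_pos_imp_n_pos:
  assumes "cycle_type n t" "pattern_var r \<pi> n t > 0"
  shows "n \<ge> 1"
proof (rule ccontr)
  assume "\<not> n \<ge> 1"
  then have "cyclic_perms n t \<subseteq> {id}" by (auto simp: cyclic_perms_def)
  then have "cyclic_perms n t = {id}" using cyclic_perms_nonempty[OF assms(1)] by blast
  then show False using assms(2) unfolding pattern_var_avg[OF assms(1)] by (simp add: avg_def)
qed

lemma normal_approximation:
  fixes \<pi> :: "nat \<Rightarrow> nat"
  assumes t: "cycle_type n t" and r: "r \<ge> 1" and V: "pattern_var r \<pi> n t > 0" and c: "c > 0"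
  shows "\<bar>cdf (scaled_pattern_law r \<pi> n t c) x - gauss_cdf (c * x / sqrt (pattern_var r \<pi> n t))\<bar>
    \<le> 42 * (real r / (fact (r - 1)) ^ 2) * (real n powr (2 * real r - 3 / 2) / pattern_var r \<pi> n t)"
proof -
  have n: "n \<ge> 1" using pattern_var_pos_imp_n_pos[OF t V] .
  have "(real n ^ (r - 1))\<^sup>2 * sqrt n = real n powr (2 * real r - 2) * real n powr (1 / 2)"
    using n r by (simp add: powr_half_sqrt powr_realpow[symmetric] powr_powr[symmetric] of_nat_diff power2_eq_square powr_add[symmetric])
  also have "\<dots> = real n powr (2 * real r - 3 / 2)" by (simp add: powr_add[symmetric])
  finally have pw: "(real n ^ (r - 1))\<^sup>2 * sqrt n = real n powr (2 * real r - 3 / 2)" .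
  have "\<bar>cdf (scaled_pattern_law r \<pi> n t c) x - gauss_cdf (c * x / sqrt (pattern_var r \<pi> n t))\<bar>
    \<le> 42 * real r * (real n ^ (r - 1) / fact (r - 1))\<^sup>2 * sqrt n / pattern_var r \<pi> n t"
    using cyclic_perms_kolmogorov_bound[OF t r n, of \<pi> "pattern_mean r \<pi> n t + c * x"] V
    unfolding cdf_scaled_pattern_law[OF t c] pattern_var_avg[OF t] pattern_mean_avg[OF t] by simp
  also have "\<dots> = 42 * (real r / (fact (r - 1)) ^ 2) * (((real n ^ (r - 1))\<^sup>2 * sqrt n) / pattern_var r \<pi> n t)"
    by (simp add: power_divide)
  finally show ?thesis unfolding pw .
qed

text \<open>
  The truth values of \<open>X - mean \<le> c * x\<close> and \<open>0 \<le> x\<close> differ only if the count \<open>X\<close> deviates from its mean by at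
  least \<open>\<bar>c * x\<bar>\<close>.  This covers the degenerate limit, where no normal approximation is available.
\<close>

lemma chebyshev_pattern:
  assumes t: "cycle_type n t" and c: "c > 0" and x: "x \<noteq> 0"
  shows "\<bar>cdf (scaled_pattern_law r \<pi> n t c) x - of_bool (0 \<le> x)\<bar> \<le> pattern_var r \<pi> n t / (c * x)\<^sup>2"
proof -
  let ?C = "cyclic_perms n t" and ?X = "\<lambda>\<tau>. real (pattern_count r \<pi> n \<tau>)" and ?m = "pattern_mean r \<pi> n t"
  have const: "avg ?C (\<lambda>_. of_bool (0 \<le> x)) = of_bool (0 \<le> x)"
    by (rule avg_const[OF finite_cyclic_perms cyclic_perms_nonempty[OF t]])
  have "\<bar>cdf (scaled_pattern_law r \<pi> n t c) x - of_bool (0 \<le> x)\<bar>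
      = \<bar>avg ?C (\<lambda>\<tau>. of_bool (?X \<tau> \<le> ?m + c * x) - of_bool (0 \<le> x))\<bar>"
    unfolding cdf_scaled_pattern_law[OF t c] avg_diff const ..
  also have "\<dots> \<le> avg ?C (\<lambda>\<tau>. (?X \<tau> - ?m)\<^sup>2 / (c * x)\<^sup>2)"
  proof (intro order_trans[OF abs_avg_le] avg_mono)
    fix \<tau>
    have "1 \<le> (?X \<tau> - ?m)\<^sup>2 / (c * x)\<^sup>2" if "\<not> (?X \<tau> \<le> ?m + c * x \<longleftrightarrow> 0 \<le> x)"
    proof -
      have "\<bar>c * x\<bar> \<le> \<bar>?X \<tau> - ?m\<bar>"
      proof (cases "0 \<le> x")
        case True
        then have "0 \<le> c * x" using c by simp
        then show ?thesis using that True by simp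
      next
        case False
        then have "c * x \<le> 0" using c by (simp add: mult_nonneg_nonpos)
        then show ?thesis using that False by simp
      qed
      then have "(c * x)\<^sup>2 \<le> (?X \<tau> - ?m)\<^sup>2" by (simp add: abs_le_square_iff)
      moreover have "(c * x)\<^sup>2 > 0" using c x by simp
      ultimately show ?thesis by (simp only: le_divide_eq_1_pos)
    qed
    moreover have "0 \<le> (?X \<tau> - ?m)\<^sup>2 / (c * x)\<^sup>2" by simp
    ultimately show "\<bar>of_bool (?X \<tau> \<le> ?m + c * x) - of_bool (0 \<le> x)\<bar> \<le> (?X \<tau> - ?m)\<^sup>2 / (c * x)\<^sup>2"
      by (cases "?X \<tau> \<le> ?m + c * x"; cases "0 \<le> x") simp_all
  qed
  also have "\<dots> = pattern_var r \<pi> n t / (c * x)\<^sup>2"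
    unfolding avg_divide pattern_var_centred[OF t] ..
  finally show ?thesis .
qed

text \<open>
  Dividing by the standard deviation transports the density \<open>normal_density 0 \<sigma>\<close> to the standard one.
\<close>

lemma cdf_centred_gaussian:
  assumes "\<sigma> > 0"
  shows "cdf (centred_gaussian \<sigma>) x = gauss_cdf (x / \<sigma>)"
proof -
  let ?N = "density lborel (\<lambda>x. ennreal (normal_density 0 \<sigma> x))"
  interpret prob_space ?N using assms by (rule prob_space_normal_density)
  have "distributed ?N lborel (\<lambda>x. x) (\<lambda>x. ennreal (normal_density 0 \<sigma> x))"
    unfolding distributed_def by (auto intro!: distr_id2)
  then have "distributed ?N lborel (\<lambda>x. (x - 0) / \<sigma>) (\<lambda>x. ennreal (std_normal_density x))"
    using normal_standard_normal_convert[OF assms, of "\<lambda>x. x" 0] by simp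
  then have d: "distr ?N lborel (\<lambda>x. x / \<sigma>) = std_normal_distribution"
    by (simp add: distributed_def)
  have "gauss_cdf (x / \<sigma>) = measure ?N ((\<lambda>x. x / \<sigma>) -` {..x / \<sigma>} \<inter> space ?N)"
    unfolding cdf_def d[symmetric] by (rule measure_distr) auto
  also have "(\<lambda>x. x / \<sigma>) -` {..x / \<sigma>} \<inter> space ?N = {..x}"
    using assms by (auto simp: divide_le_cancel)
  finally show ?thesis using assms by (simp add: centred_gaussian_def cdf_def)
qed

lemma cdf_dirac_0:
  assumes "isCont (cdf (centred_gaussian 0)) x"
  shows "x \<noteq> 0" "cdf (centred_gaussian 0) x = of_bool (0 \<le> x)"
proof -
  interpret real_distribution "return borel (0 :: real)"
    by (intro real_distribution.intro prob_space_return real_distribution_axioms.intro) auto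
  show "x \<noteq> 0" using assms by (auto simp: centred_gaussian_def isCont_cdf measure_return)
  show "cdf (centred_gaussian 0) x = of_bool (0 \<le> x)"
    by (simp add: centred_gaussian_def cdf_def measure_return indicator_def)
qed

section \<open>Convergence to the Gaussian law\<close>

text \<open>
  The quantitative part is \<open>normal_approximation\<close> at the scale \<open>sqrt V\<close>.  For the limit theorem put
  \<open>a n = n powr (r - 1/2)\<close>, so that \<open>V n / (a n)\<^sup>2\<close> tends to \<open>\<sigma>\<^sup>2\<close>.  If \<open>\<sigma> > 0\<close>, the bound is of order
  \<open>n powr (-1/2)\<close> and holds at the scale \<open>a n\<close> as well, where the Gaussian term is
  \<open>\<Phi> (a n * x / sqrt (V n))\<close> and converges to \<open>\<Phi> (x / \<sigma>)\<close>.  If \<open>\<sigma> = 0\<close>, the point \<open>x = 0\<close> is a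
  discontinuity of the limit, and Chebyshev's inequality handles the other points.
\<close>

theorem theorem2p14:
  fixes t :: "nat \<Rightarrow> nat \<Rightarrow> nat" and r :: nat and \<pi> :: "nat \<Rightarrow> nat"
  assumes "\<And>n. cycle_type n (t n)"
    and "r \<ge> 1"
    and "\<pi> permutes {1..r}"
  shows
    "(\<forall>n. pattern_var r \<pi> n (t n) > 0 \<longrightarrow>
        kolmogorov_dist (scaled_pattern_law r \<pi> n (t n) (sqrt (pattern_var r \<pi> n (t n))))
            std_normal_distribution
          \<le> 42 * (real r / (fact (r - 1)) ^ 2)
                * (real n powr (2 * real r - 3 / 2) / pattern_var r \<pi> n (t n))
            + 72 * (real r / (fact (r - 1)) ^ 3)
                * (real n powr (3 * real r - 2) / pattern_var r \<pi> n (t n) powr (3 / 2)))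
     \<and> (\<forall>\<sigma>::real. \<sigma> \<ge> 0 \<longrightarrow>
          (\<lambda>n. pattern_var r \<pi> n (t n) - \<sigma>\<^sup>2 * real n powr (2 * real r - 1))
            \<in> o(\<lambda>n. real n powr (2 * real r - 1)) \<longrightarrow>
          weak_conv_m (\<lambda>n. scaled_pattern_law r \<pi> n (t n) (real n powr (real r - 1 / 2)))
            (centred_gaussian \<sigma>)
          \<and> (\<sigma> > 0 \<longrightarrow>
              (\<lambda>n. kolmogorov_dist
                     (scaled_pattern_law r \<pi> n (t n) (sqrt (pattern_var r \<pi> n (t n))))
                     std_normal_distribution)
                \<in> O(\<lambda>n. real n powr (- 1 / 2))))"
proof -
  define V where "V n = pattern_var r \<pi> n (t n)" for n
  define K where "K = 42 * (real r / (fact (r - 1)) ^ 2)"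
  define a where "a n = real n powr (real r - 1 / 2)" for n :: nat
  have K: "K \<ge> 0" by (simp add: K_def)
  have dist: "\<bar>kolmogorov_dist (scaled_pattern_law r \<pi> n (t n) (sqrt (V n))) std_normal_distribution\<bar>
      \<le> K * (real n powr (2 * real r - 3 / 2) / V n)" if "V n > 0" for n
  proof (rule abs_kolmogorov_dist_le)
    fix x
    show "\<bar>cdf (scaled_pattern_law r \<pi> n (t n) (sqrt (V n))) x - gauss_cdf x\<bar> \<le> K * (real n powr (2 * real r - 3 / 2) / V n)"
      using normal_approximation[OF assms(1,2), of \<pi> n "sqrt (V n)" x] that by (simp add: V_def K_def)
  qed
  have part1: "kolmogorov_dist (scaled_pattern_law r \<pi> n (t n) (sqrt (V n))) std_normal_distribution
      \<le> K * (real n powr (2 * real r - 3 / 2) / V n)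
        + 72 * (real r / (fact (r - 1)) ^ 3) * (real n powr (3 * real r - 2) / V n powr (3 / 2))" if "V n > 0" for n
  proof -
    have "0 \<le> 72 * (real r / (fact (r - 1)) ^ 3) * (real n powr (3 * real r - 2) / V n powr (3 / 2))" by simp
    then show ?thesis using dist[OF that] by linarith
  qed
  have part2: "weak_conv_m (\<lambda>n. scaled_pattern_law r \<pi> n (t n) (a n)) (centred_gaussian \<sigma>)
      \<and> (\<sigma> > 0 \<longrightarrow> (\<lambda>n. kolmogorov_dist (scaled_pattern_law r \<pi> n (t n) (sqrt (V n))) std_normal_distribution)
                \<in> O(\<lambda>n. real n powr (- 1 / 2)))"
    if \<sigma>: "\<sigma> \<ge> 0" and o: "(\<lambda>n. V n - \<sigma>\<^sup>2 * real n powr (2 * real r - 1)) \<in> o(\<lambda>n. real n powr (2 * real r - 1))" for \<sigma> :: real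
  proof -
    have a_pos: "a n > 0" if "n \<ge> 1" for n using that by (simp add: a_def)
    have a_sq: "(a n)\<^sup>2 = real n powr (2 * real r - 1)" for n
      by (simp add: a_def power2_eq_square powr_add[symmetric])
    have ratio: "(\<lambda>n. V n / (a n)\<^sup>2) \<longlonglongrightarrow> \<sigma>\<^sup>2"
    proof -
      have "(\<lambda>n. (V n - \<sigma>\<^sup>2 * (a n)\<^sup>2) / (a n)\<^sup>2 + \<sigma>\<^sup>2) \<longlonglongrightarrow> 0 + \<sigma>\<^sup>2"
        using o unfolding a_sq by (intro tendsto_add smalloD_tendsto tendsto_const)
      moreover have "\<forall>\<^sub>F n in sequentially. (V n - \<sigma>\<^sup>2 * (a n)\<^sup>2) / (a n)\<^sup>2 + \<sigma>\<^sup>2 = V n / (a n)\<^sup>2"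
        using eventually_ge_at_top[of 1]
      proof eventually_elim
        case (elim n)
        then show ?case using a_pos[of n] by (simp add: diff_divide_distrib)
      qed
      ultimately show ?thesis by (simp add: Lim_transform_eventually)
    qed
    show ?thesis
    proof (cases "\<sigma> = 0")
      case True
      have "(\<lambda>n. cdf (scaled_pattern_law r \<pi> n (t n) (a n)) x) \<longlonglongrightarrow> cdf (centred_gaussian \<sigma>) x"
        if "isCont (cdf (centred_gaussian \<sigma>)) x" for x
      proof -
        have x: "x \<noteq> 0" "cdf (centred_gaussian \<sigma>) x = of_bool (0 \<le> x)" using that cdf_dirac_0 True by auto
        have "\<forall>\<^sub>F n in sequentially. norm (cdf (scaled_pattern_law r \<pi> n (t n) (a n)) x - of_bool (0 \<le> x)) \<le> V n / (a n)\<^sup>2 / x\<^sup>2"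
          using eventually_ge_at_top[of 1]
        proof eventually_elim
          case (elim n)
          show ?case using chebyshev_pattern[OF assms(1) a_pos[OF elim] x(1), of r \<pi>]
            by (simp add: V_def power_mult_distrib)
        qed
        moreover have "(\<lambda>n. V n / (a n)\<^sup>2 / x\<^sup>2) \<longlonglongrightarrow> 0"
          using tendsto_divide[OF ratio tendsto_const, of "x\<^sup>2"] x True by simp
        ultimately have "(\<lambda>n. cdf (scaled_pattern_law r \<pi> n (t n) (a n)) x - of_bool (0 \<le> x)) \<longlonglongrightarrow> 0"
          by (rule Lim_null_comparison)
        then show ?thesis unfolding x(2) by (simp add: LIM_zero_iff)
      qed
      then show ?thesis using True by (simp add: weak_conv_m_def weak_conv_def)
    next
      case False
      then have \<sigma>: "\<sigma> > 0" using \<sigma> by simp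
      have "\<forall>\<^sub>F n in sequentially. V n / (a n)\<^sup>2 > \<sigma>\<^sup>2 / 2" using \<sigma> by (intro order_tendstoD(1)[OF ratio]) simp
      with eventually_ge_at_top[of 1]
      have ev: "\<forall>\<^sub>F n in sequentially. n \<ge> 1 \<and> V n > 0 \<and>
          K * (real n powr (2 * real r - 3 / 2) / V n) \<le> 2 * K / \<sigma>\<^sup>2 * real n powr (- 1 / 2)"
      proof eventually_elim
        case (elim n)
        have "0 < \<sigma>\<^sup>2 / 2 * (a n)\<^sup>2" using \<sigma> a_pos[OF elim(1)] by simp
        also have lt: "\<sigma>\<^sup>2 / 2 * (a n)\<^sup>2 < V n" using elim(2) a_pos[OF elim(1)] by (simp add: pos_less_divide_eq)
        finally have "V n > 0" .
        have "real n powr (2 * real r - 3 / 2) = real n powr (- 1 / 2) * (a n)\<^sup>2"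
          unfolding a_sq powr_add[symmetric] by simp
        moreover have "real n powr (- 1 / 2) * (a n)\<^sup>2 / V n \<le> real n powr (- 1 / 2) * (a n)\<^sup>2 / (\<sigma>\<^sup>2 / 2 * (a n)\<^sup>2)"
          by (rule divide_left_mono[OF less_imp_le[OF lt]])
            (use \<open>0 < V n\<close> \<open>0 < \<sigma>\<^sup>2 / 2 * (a n)\<^sup>2\<close> in \<open>auto intro: mult_pos_pos\<close>)
        ultimately have "real n powr (2 * real r - 3 / 2) / V n \<le> real n powr (- 1 / 2) * (a n)\<^sup>2 / (\<sigma>\<^sup>2 / 2 * (a n)\<^sup>2)"
          by simp
        also have "\<dots> = 2 / \<sigma>\<^sup>2 * real n powr (- 1 / 2)" using a_pos[OF elim(1)] by simp
        finally have "K * (real n powr (2 * real r - 3 / 2) / V n) \<le> K * (2 / \<sigma>\<^sup>2 * real n powr (- 1 / 2))"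
          using K by (rule mult_left_mono)
        then show ?case using elim \<open>V n > 0\<close> by (simp add: mult_ac)
      qed
      have "(\<lambda>n. kolmogorov_dist (scaled_pattern_law r \<pi> n (t n) (sqrt (V n))) std_normal_distribution)
                \<in> O(\<lambda>n. real n powr (- 1 / 2))"
      proof (rule bigoI[of _ "2 * K / \<sigma>\<^sup>2"])
        show "\<forall>\<^sub>F n in sequentially. norm (kolmogorov_dist (scaled_pattern_law r \<pi> n (t n) (sqrt (V n))) std_normal_distribution)
            \<le> 2 * K / \<sigma>\<^sup>2 * norm (real n powr (- 1 / 2))"
          using ev
        proof eventually_elim
          case (elim n)
          then show ?case using dist[of n] by simp
        qed
      qed
      moreover have "(\<lambda>n. cdf (scaled_pattern_law r \<pi> n (t n) (a n)) x) \<longlonglongrightarrow> cdf (centred_gaussian \<sigma>) x" for x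
      proof -
        have "(\<lambda>n. x / sqrt (V n / (a n)\<^sup>2)) \<longlonglongrightarrow> x / sqrt (\<sigma>\<^sup>2)"
          using \<sigma> by (intro tendsto_divide tendsto_const tendsto_real_sqrt ratio) simp
        then have "(\<lambda>n. gauss_cdf (x / sqrt (V n / (a n)\<^sup>2))) \<longlonglongrightarrow> gauss_cdf (x / \<sigma>)"
          using \<sigma> by (intro isCont_tendsto_compose[OF DERIV_isCont[OF gauss_cdf_deriv]]) simp
        moreover have "(\<lambda>n. cdf (scaled_pattern_law r \<pi> n (t n) (a n)) x - gauss_cdf (x / sqrt (V n / (a n)\<^sup>2))) \<longlonglongrightarrow> 0"
        proof (rule Lim_null_comparison)
          show "\<forall>\<^sub>F n in sequentially. norm (cdf (scaled_pattern_law r \<pi> n (t n) (a n)) x - gauss_cdf (x / sqrt (V n / (a n)\<^sup>2)))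
              \<le> 2 * K / \<sigma>\<^sup>2 * real n powr (- 1 / 2)"
            using ev
          proof eventually_elim
            case (elim n)
            have "x / sqrt (V n / (a n)\<^sup>2) = a n * x / sqrt (V n)"
              using a_pos[of n] elim by (simp add: real_sqrt_divide)
            then show ?case
              using normal_approximation[OF assms(1,2), of \<pi> n "a n" x] a_pos[of n] elim by (simp add: V_def K_def)
          qed
          have "(\<lambda>n. real n powr (- 1 / 2)) \<longlonglongrightarrow> 0" by real_asymp
          then show "(\<lambda>n. 2 * K / \<sigma>\<^sup>2 * real n powr (- 1 / 2)) \<longlonglongrightarrow> 0" by (rule tendsto_mult_right_zero)
        qed
        ultimately have "(\<lambda>n. (cdf (scaled_pattern_law r \<pi> n (t n) (a n)) x - gauss_cdf (x / sqrt (V n / (a n)\<^sup>2)))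
            + gauss_cdf (x / sqrt (V n / (a n)\<^sup>2))) \<longlonglongrightarrow> 0 + gauss_cdf (x / \<sigma>)"
          by (intro tendsto_add)
        then show ?thesis unfolding cdf_centred_gaussian[OF \<sigma>] by simp
      qed
      ultimately show ?thesis by (simp add: weak_conv_m_def weak_conv_def)
    qed
  qed
  show ?thesis
    using part1 part2 unfolding V_def K_def a_def by blast
qed

end
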